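(* Let $(r(n))_{n\in\mathbb{Z}}$ be independent random variables, each uniformly distributed on the segment $[-\tfrac12,\tfrac12]$, and set $\lambda(n)=n+r(n)$ for $n\in\mathbb{Z}$. Then, almost surely, the sequence $\Lambda=\{\lambda(n)\}_{n\in\mathbb{Z}}$ is a Menshov spectrum for $\mathbb{R}$; that is, almost surely, for every measurable function $f:\mathbb{R}\to\mathbb{C}$ there exist coefficients $\{c(n)\}_{n\in\mathbb{Z}}$ such that \[ f(t)=\lim_{x\to\infty}\sum_{n:\,|\lambda(n)|<x} c(n)e^{i\lambda(n)t}\quad\text{for almost every } t\in\mathbb{R}. \]
   Context: A sequence $\Lambda=\{\lambda(k)\}_{k\in\mathbb{Z}}$ of real numbers with $\dots<\lambda(-1)<\lambda(0)<\lambda(1)<\dots$ is called a Menshov spectrum for $\mathbb{R}$ if for every measurable (complex-valued, a.e. finite) function $f$ on $\mathbb{R}$ there are coefficients $\{c(k)\}$ such that $f(t)=\sum_{k\in\mathbb{Z}}c(k)e^{i\lambda(k)t}$ almost everywhere, where convergence of the series is understood as the limit of the symmetric partial sums $\lim_{x\to\infty}\sum_{|\lambda(k)|<x}c(k)e^{i\lambda(k)t}$. (Almost surely the random sequence above is strictly increasing.) *)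

theory Defs
  imports "HOL-Probability.Probability"
begin

definition Menshov_spectrum :: "(int \<Rightarrow> real) \<Rightarrow> bool" where
  "Menshov_spectrum lam \<longleftrightarrow>
     strict_mono lam \<and>
     (\<forall>f :: real \<Rightarrow> complex. f \<in> borel_measurable lebesgue \<longrightarrow>
        (\<exists>c :: int \<Rightarrow> complex. AE t in lebesgue.
           ((\<lambda>x. \<Sum>k\<in>{k. \<bar>lam k\<bar> < x}. c k * exp (\<i> * complex_of_real (lam k * t)))
              \<longlongrightarrow> f t) at_top))"

end

theory Submission
  imports Defs
begin

text \<open>
  Almost surely every finite pattern recurs: for all tolerances, all offsets p(b) in [-1/2,1/2]
  (\<bar>b\<bar> \<le> W) and all M there are arbitrarily large N with r(mN+b) close to p(b) whenever 0 < \<bar>m\<bar> \<le> M.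
  The rest of the argument is deterministic.

  Let D(u) be a trigonometric polynomial without constant term (one minus a Poisson kernel, truncated)
  that is close to 1 unless u is within about c of 2\<pi>\<int>, and whose symmetric partial sums are
  bounded by 8/c there. Multiplying an exponential by D(Nt) moves its frequency to distinct integer
  bins far away while changing it only on a set of small measure. Hence every measurable g is
  approximated in measure by some G having at most one frequency in each unit bin, and then G(t)D(Nt)
  can be realised, up to a small error, with frequencies from the random spectrum. The average of R such products with
  exceptional sets of measure \<epsilon>/R has small coefficients, and its partial sums at t are bounded by
  C(\<epsilon>) \<bar>g(t)\<bar> off a set of measure \<epsilon>, where C(\<epsilon>) does not depend on R or g.
  Since the bound is pointwise in g, one may correct the residual of f repeatedly: where the residual
  is already small, the next correction oscillates little, and Borel-Cantelli gives convergence a.e.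
\<close>

section \<open>The kernel\<close>

text \<open>With \<open>a n = - (\<rho> ^ n)\<close> the sum is one minus a truncated Poisson
  kernel. For \<rho> near 1 the Poisson kernel is small away from the multiples of 2 pi, and a long
  truncation changes it little. The closed form of the geometric sum bounds all partial sums by 8 /
  c, whatever \<eta> is.\<close>

lemma damped_geometric_kernel:
  fixes c \<eta> :: real
  assumes c: "c > 0" and \<eta>: "\<eta> > 0"
  shows "\<exists>(M::nat) (a::nat \<Rightarrow> real). (\<forall>n. \<bar>a n\<bar> \<le> 1) \<and>
    (\<forall>u. c \<le> norm (1 - cis u) \<longrightarrow>
       norm ((\<Sum>m\<in>{-int M..int M}-{0}. of_real (a (nat \<bar>m\<bar>)) * cis (of_int m * u)) - 1) \<le> \<eta> \<and>
       (\<forall>J\<le>M. norm (\<Sum>m\<in>{-int J..int J}-{0}. of_real (a (nat \<bar>m\<bar>)) * cis (of_int m * u)) \<le> 8 / c))"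
proof -
  \<comment> \<open>Here d = 1 - \<rho>. The Poisson kernel turns out to be at most 2 d / (c/2)^2,
    which the second entry of the minimum makes at most \<eta> / 2. The other half of \<eta> is left
    for the truncation at \<open>M\<close>.\<close>
  define d where "d = min (1/2) (\<eta> * c\<^sup>2 / 16)"
  have d: "0 < d" "d \<le> 1/2" "d \<le> \<eta> * c\<^sup>2 / 16" using c \<eta> by (auto simp: d_def)
  define \<rho> where "\<rho> = 1 - d"
  have \<rho>: "0 < \<rho>" "\<rho> < 1" using d by (auto simp: \<rho>_def)
  have "(\<lambda>M. 4 * \<rho> ^ M / c) \<longlonglongrightarrow> 4 * 0 / c"
    using \<rho> c by (intro tendsto_intros) auto
  then have "eventually (\<lambda>M. 4 * \<rho> ^ M / c < \<eta> / 2) sequentially"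
    using \<eta> by (intro order_tendstoD) auto
  then obtain M where M: "4 * \<rho> ^ M / c < \<eta> / 2"
    by (auto simp: eventually_sequentially)
  define a where "a = (\<lambda>n::nat. - (\<rho> ^ n))"
  have a1: "\<bar>a n\<bar> \<le> 1" for n
    using \<rho> by (simp add: a_def power_le_one)
  have *: "norm ((\<Sum>m\<in>{-int M..int M}-{0}. of_real (a (nat \<bar>m\<bar>)) * cis (of_int m * u)) - 1) \<le> \<eta> \<and>
       (\<forall>J\<le>M. norm (\<Sum>m\<in>{-int J..int J}-{0}. of_real (a (nat \<bar>m\<bar>)) * cis (of_int m * u)) \<le> 8 / c)"
    if u: "c \<le> norm (1 - cis u)" for u
  proof -
    define w where "w = of_real \<rho> * cis u"
    have nw: "norm w = \<rho>" using \<rho> by (simp add: w_def norm_mult)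
    have ge1: "1 - \<rho> \<le> norm (1 - w)"
      using norm_triangle_ineq2[of 1 w] nw by simp
    \<comment> \<open>Moving from \<open>cis u\<close> to \<open>w\<close> costs 1 - \<rho>, which
      is itself at most the distance from \<open>w\<close> to 1. Hence at most half of the distance
      c is lost.\<close>
    have "norm (1 - cis u) \<le> norm (1 - w) + norm (w - cis u)"
      using norm_triangle_ineq[of "1 - w" "w - cis u"] by simp
    also have "w - cis u = of_real (\<rho> - 1) * cis u" by (simp add: w_def algebra_simps)
    also have "norm \<dots> = 1 - \<rho>" using \<rho> by (simp only: norm_mult norm_of_real norm_cis) simp
    finally have dw: "c / 2 \<le> norm (1 - w)" using ge1 u by linarith
    have w1: "1 - w \<noteq> 0" using dw c by auto
    have cw: "cnj w = of_real \<rho> * cis (-u)" by (simp add: w_def cis_cnj)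
    \<comment> \<open>The terms m and -m are conjugate, so the sum is minus twice the real part of w
      + ... + w^J.\<close>
    have sum_eq: "(\<Sum>m\<in>{-int J..int J}-{0}. of_real (a (nat \<bar>m\<bar>)) * cis (of_int m * u))
       = - of_real (2 * Re (w * (1 - w ^ J) / (1 - w)))" for J
    proof (induction J)
      case 0 show ?case by simp
    next
      case (Suc J)
      have set: "{-int (Suc J)..int (Suc J)}-{0} = insert (int (Suc J)) (insert (- int (Suc J)) ({-int J..int J}-{0}))"
        by auto
      have nats: "nat \<bar>int (Suc J)\<bar> = Suc J" "nat \<bar>- int (Suc J)\<bar> = Suc J" by simp_all
      have "w ^ Suc J = of_real (\<rho> ^ Suc J) * cis (of_int (int (Suc J)) * u)"
        unfolding w_def power_mult_distrib Complex.DeMoivre by simp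
      moreover have "cnj w ^ Suc J = of_real (\<rho> ^ Suc J) * cis (of_int (- int (Suc J)) * u)"
        unfolding cw power_mult_distrib Complex.DeMoivre by (simp add: algebra_simps)
      ultimately have "(\<Sum>m\<in>{-int (Suc J)..int (Suc J)}-{0}. of_real (a (nat \<bar>m\<bar>)) * cis (of_int m * u))
         = - (w ^ Suc J) - cnj w ^ Suc J - of_real (2 * Re (w * (1 - w ^ J) / (1 - w)))"
        unfolding set by (subst sum.insert, simp, simp, subst sum.insert, simp, simp, subst Suc)
          (simp only: nats a_def of_real_minus mult_minus_left diff_conv_add_uminus add.assoc)
      also have "w ^ Suc J + cnj w ^ Suc J = of_real (2 * Re (w ^ Suc J))"
        using complex_add_cnj[of "w ^ Suc J"] by simp
      then have "- (w ^ Suc J) - cnj w ^ Suc J = - of_real (2 * Re (w ^ Suc J))"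
        by (metis minus_add_distrib uminus_add_conv_diff add.commute)
      also have "- of_real (2 * Re (w ^ Suc J)) - of_real (2 * Re (w * (1 - w ^ J) / (1 - w)))
         = - (of_real (2 * Re (w ^ Suc J + w * (1 - w ^ J) / (1 - w))) :: complex)"
        by simp
      also have "w ^ Suc J + w * (1 - w ^ J) / (1 - w) = w * (1 - w ^ Suc J) / (1 - w)"
        using w1 by (simp add: field_simps)
      finally show ?case .
    qed
    have b1: "norm (\<Sum>m\<in>{-int J..int J}-{0}. of_real (a (nat \<bar>m\<bar>)) * cis (of_int m * u)) \<le> 8 / c" for J
    proof -
      have "norm (1 - w ^ J) \<le> 1 + \<rho> ^ J"
        using norm_triangle_ineq4[of 1 "w ^ J"] by (simp add: norm_power nw)
      also have "\<dots> \<le> 2" using \<rho> by (simp add: power_le_one)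
      finally have "norm w * norm (1 - w ^ J) \<le> 1 * 2" unfolding nw using \<rho> by (intro mult_mono) auto
      then have "norm (w * (1 - w ^ J) / (1 - w)) \<le> 2 / (c / 2)"
        unfolding norm_divide norm_mult using dw c by (intro frac_le) auto
      then have "\<bar>Re (w * (1 - w ^ J) / (1 - w))\<bar> \<le> 4 / c"
        using abs_Re_le_cmod[of "w * (1 - w ^ J) / (1 - w)"] by simp
      then show ?thesis unfolding sum_eq by (simp only: norm_minus_cancel norm_of_real abs_mult)
    qed
    \<comment> \<open>Splitting off the tail leaves 1 + 2 Re (w / (1 - w)) = Re ((1 + w) / (1 - w)),
      the full Poisson kernel.\<close>
    have "w * (1 - w ^ M) / (1 - w) = w / (1 - w) - w ^ Suc M / (1 - w)"
      by (simp add: diff_divide_distrib[symmetric] right_diff_distrib)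
    then have 1: "2 * Re (w * (1 - w ^ M) / (1 - w)) + 1 = (2 * Re (w / (1 - w)) + 1) - 2 * Re (w ^ Suc M / (1 - w))"
      by simp
    have "2 * Re (w / (1 - w)) + 1 = Re ((1 + w) / (1 - w))"
    proof -
      have "(1 + w) / (1 - w) = (w + w + (1 - w)) / (1 - w)" by simp
      also have "\<dots> = w / (1 - w) + w / (1 - w) + 1" by (simp only: add_divide_distrib divide_self[OF w1])
      finally have "(1 + w) / (1 - w) = w / (1 - w) + w / (1 - w) + 1" .
      then show ?thesis by (simp only: plus_complex.simps one_complex.simps)
    qed
    also have "(1 + w) / (1 - w) = ((1 + w) * cnj (1 - w)) / of_real ((norm (1 - w))\<^sup>2)"
      using complex_div_cnj[of "1 + w" "1 - w"] by simp
    also have "Re \<dots> = Re ((1 + w) * cnj (1 - w)) / (norm (1 - w))\<^sup>2"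
      by (simp only: Re_divide_of_real)
    also have "Re ((1 + w) * cnj (1 - w)) = 1 - (norm w)\<^sup>2"
      by (simp only: cmod_power2) (simp add: algebra_simps power2_eq_square)
    finally have 2: "2 * Re (w / (1 - w)) + 1 = (1 - \<rho>\<^sup>2) / (norm (1 - w))\<^sup>2" unfolding nw .
    have "1 - \<rho>\<^sup>2 \<le> 2 * d" by (simp add: \<rho>_def power2_eq_square algebra_simps)
    then have "(1 - \<rho>\<^sup>2) / (norm (1 - w))\<^sup>2 \<le> (2 * d) / (c / 2)\<^sup>2"
      using dw c d by (intro frac_le power_mono) auto
    also have "\<dots> \<le> \<eta> / 2"
      using d c by (simp add: field_simps power2_eq_square)
    finally have 3: "(1 - \<rho>\<^sup>2) / (norm (1 - w))\<^sup>2 \<le> \<eta> / 2" .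
    have 4: "0 \<le> (1 - \<rho>\<^sup>2) / (norm (1 - w))\<^sup>2"
      using \<rho> by (simp add: power_le_one)
    have "norm (w ^ Suc M / (1 - w)) \<le> \<rho> ^ M / (c / 2)"
      unfolding norm_divide norm_power nw using dw c \<rho>
      by (intro frac_le) (auto simp: mult_left_le_one_le)
    then have "\<bar>2 * Re (w ^ Suc M / (1 - w))\<bar> \<le> 4 * \<rho> ^ M / c"
      using abs_Re_le_cmod[of "w ^ Suc M / (1 - w)"] by simp
    with M have 5: "\<bar>2 * Re (w ^ Suc M / (1 - w))\<bar> \<le> \<eta> / 2" by linarith
    have "(\<Sum>m\<in>{-int M..int M}-{0}. of_real (a (nat \<bar>m\<bar>)) * cis (of_int m * u)) - 1
      = - (of_real (2 * Re (w * (1 - w ^ M) / (1 - w)) + 1) :: complex)"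
      unfolding sum_eq by simp
    then have "norm ((\<Sum>m\<in>{-int M..int M}-{0}. of_real (a (nat \<bar>m\<bar>)) * cis (of_int m * u)) - 1)
      = \<bar>2 * Re (w * (1 - w ^ M) / (1 - w)) + 1\<bar>"
      by (simp only: norm_minus_cancel norm_of_real)
    also have "\<dots> \<le> \<eta>" unfolding 1 2 using 3 4 5 by linarith
    finally show ?thesis using b1 by blast
  qed
  show ?thesis using a1 * by blast
qed

text \<open>Taylor's formula gives an error of at most |y|^3 / 6. The bound 8/5 is a rational number
  above pi / 2 for which |y|^2 / 6 is still at most 1/2.\<close>

lemma half_abs_le_abs_sin:
  fixes y :: real assumes "\<bar>y\<bar> \<le> 8/5" shows "\<bar>y\<bar> / 2 \<le> \<bar>sin y\<bar>"
proof -
  have "\<bar>sin y - (\<Sum>m<3. sin_coeff m * y ^ m)\<bar> \<le> inverse (fact 3) * \<bar>y\<bar> ^ 3"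
    by (rule Maclaurin_sin_bound)
  then have "\<bar>sin y - y\<bar> \<le> \<bar>y\<bar> ^ 3 / 6"
    by (simp add: sin_coeff_def eval_nat_numeral field_simps)
  also have "\<bar>y\<bar> ^ 3 / 6 = \<bar>y\<bar> * (\<bar>y\<bar>\<^sup>2 / 6)" by (simp add: eval_nat_numeral)
  also have "\<bar>y\<bar>\<^sup>2 \<le> (8/5)\<^sup>2" using assms by (intro power_mono) auto
  then have "\<bar>y\<bar> * (\<bar>y\<bar>\<^sup>2 / 6) \<le> \<bar>y\<bar> * (1/2)" by (intro mult_left_mono) (auto simp: power2_eq_square)
  finally show ?thesis by linarith
qed

lemma half_abs_le_norm_one_minus_cis:
  fixes x :: real assumes "\<bar>x\<bar> \<le> pi" shows "\<bar>x\<bar> / 2 \<le> norm (1 - cis x)"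
proof -
  have "\<bar>x / 2\<bar> \<le> 8/5" using assms pi_less_4 pi_approx(2) by simp
  then have "\<bar>x / 2\<bar> / 2 \<le> \<bar>sin (x / 2)\<bar>" by (rule half_abs_le_abs_sin)
  moreover have "norm (1 - cis x) = 2 * \<bar>sin (x / 2)\<bar>"
    using dist_exp_i_1[of x] by (simp add: cis_conv_exp norm_minus_commute)
  ultimately show ?thesis by simp
qed

text \<open>The set is covered by intervals of length 4c / N around the points 2 pi k / N. About N A
  / pi of them meet [-A, A], so N cancels. A bound uniform in N is needed because N is dictated
  later by the recurrence of a pattern.\<close>

lemma measure_cis_near_one:
  fixes A c :: real and N :: int
  assumes A: "A \<ge> 0" and c: "c > 0" and N: "N \<ge> 1"
  defines "E \<equiv> {t \<in> {-A..A}. norm (1 - cis (of_int N * t)) < c}"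
  shows "E \<in> lmeasurable" "measure lebesgue E \<le> (2 * A + 12) * c"
proof -
  have Nr: "real_of_int N \<ge> 1" using N by linarith
  have "open {t. norm (1 - cis (of_int N * t)) < c}"
    by (intro open_Collect_less continuous_intros)
  then have "{t. norm (1 - cis (of_int N * t)) < c} \<in> sets lebesgue" by (simp add: borel_open)
  then have "{-A..A} \<inter> {t. norm (1 - cis (of_int N * t)) < c} \<in> lmeasurable"
    by (intro fmeasurable_Int_fmeasurable) (auto simp: lmeasurable_cbox[of "-A" A, simplified])
  moreover have "E = {-A..A} \<inter> {t. norm (1 - cis (of_int N * t)) < c}" by (auto simp: E_def)
  ultimately show E: "E \<in> lmeasurable" by simp
  \<comment> \<open>The relevant k satisfy |k| \<le> N A / (2 pi) + 1/2; the number 6 replaces 2 pi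
    from below.\<close>
  define K where "K = \<lfloor>of_int N * A / 6\<rfloor> + 1"
  have NA: "0 \<le> of_int N * A / 6" using A Nr by simp
  then have K0: "0 \<le> K" unfolding K_def by simp
  define B where "B = (\<lambda>k::int. cball (2 * pi * of_int k / of_int N) (2 * c / of_int N) :: real set)"
  have "E \<subseteq> (\<Union>k\<in>{-K..K}. B k)"
  proof
    fix t assume t: "t \<in> E"
    \<comment> \<open>The nearest multiple of 2 pi is subtracted, so that the remaining angle
      \<open>x\<close> lies in [-pi, pi], where the chord controls the angle.\<close>
    define k where "k = round (of_int N * t / (2 * pi))"
    define x where "x = of_int N * t - 2 * pi * of_int k"
    have "\<bar>of_int k - of_int N * t / (2 * pi)\<bar> \<le> 1 / 2"
      unfolding k_def by (rule of_int_round_abs_le)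
    then have kk: "\<bar>of_int N * t / (2 * pi) - of_int k\<bar> \<le> 1 / 2" by linarith
    have "x = 2 * pi * (of_int N * t / (2 * pi) - of_int k)" by (simp add: x_def field_simps)
    then have "\<bar>x\<bar> = 2 * pi * \<bar>of_int N * t / (2 * pi) - of_int k\<bar>" by (simp add: abs_mult)
    also have "\<dots> \<le> 2 * pi * (1/2)" using kk by (intro mult_left_mono) auto
    finally have "\<bar>x\<bar> / 2 \<le> norm (1 - cis x)" by (intro half_abs_le_norm_one_minus_cis) simp
    also have "cis x = cis (of_int N * t)"
      unfolding x_def by (subst cis_divide[symmetric]) (simp add: cis_multiple_2pi)
    also have "norm (1 - \<dots>) < c" using t by (simp add: E_def)
    finally have xc: "\<bar>x\<bar> < 2 * c" by simp
    have "2 * pi * of_int k / of_int N - t = - x / of_int N" using Nr by (simp add: x_def field_simps)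
    then have "\<bar>2 * pi * of_int k / of_int N - t\<bar> = \<bar>x\<bar> / of_int N" using Nr by simp
    also have "\<dots> \<le> 2 * c / of_int N" using xc Nr by (intro divide_right_mono) auto
    finally have tB: "t \<in> B k" by (simp add: B_def dist_real_def)
    have "\<bar>of_int N * t / (2 * pi)\<bar> = of_int N * \<bar>t\<bar> / (2 * pi)" using Nr by (simp add: abs_mult)
    also have "\<dots> \<le> of_int N * A / 6"
      using t Nr A pi_gt3 by (intro frac_le mult_left_mono) (auto simp: E_def)
    finally have "\<bar>real_of_int k\<bar> \<le> of_int N * A / 6 + 1/2" using kk by linarith
    then have "\<bar>k\<bar> \<le> K" unfolding K_def by linarith
    then show "t \<in> (\<Union>k\<in>{-K..K}. B k)" using tB by (intro UN_I[of k]) auto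
  qed
  moreover have Bm: "B k \<in> lmeasurable" for k by (simp add: B_def)
  then have "(\<Union>k\<in>{-K..K}. B k) \<in> lmeasurable" by (intro fmeasurable.finite_UN) auto
  ultimately have "measure lebesgue E \<le> measure lebesgue (\<Union>k\<in>{-K..K}. B k)"
    using E by (intro measure_mono_fmeasurable) auto
  also have "\<dots> \<le> (\<Sum>k\<in>{-K..K}. measure lebesgue (B k))"
    using Bm by (intro measure_UNION_le) (auto intro: fmeasurableD)
  also have "\<dots> = (\<Sum>k\<in>{-K..K}. 4 * c / of_int N)"
    using c Nr by (intro sum.cong) (auto simp: B_def cball_eq_atLeastAtMost)
  also have "\<dots> = (2 * of_int K + 1) * (4 * c / of_int N)" using K0 by simp
  also have "\<dots> \<le> (2 * (of_int N * A / 6 + 1) + 1) * (4 * c / of_int N)"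
    using c Nr of_int_floor_le[of "of_int N * A / 6"]
    by (intro mult_right_mono) (simp_all add: K_def mult.commute del: of_int_floor_le)
  also have "\<dots> = (4 * A / 3) * c + 12 * c / of_int N" using Nr by (simp add: field_simps)
  also have "\<dots> \<le> (2 * A) * c + 12 * c"
    using Nr A c by (intro add_mono mult_right_mono) (auto simp: field_simps)
  finally show "measure lebesgue E \<le> (2 * A + 12) * c" by (simp add: algebra_simps)
qed

section \<open>Symmetric partial sums and polynomials with one frequency per bin\<close>

definition psum :: "(int \<Rightarrow> real) \<Rightarrow> (int \<Rightarrow> complex) \<Rightarrow> real \<Rightarrow> real \<Rightarrow> complex" where
  "psum lam f x t = (\<Sum>k\<in>{k. \<bar>lam k\<bar> < x}. f k * cis (lam k * t))"

text \<open>This makes the symmetric partial sums finite and lets cutoffs in |lam k| be exchanged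
  with cutoffs in |k|.\<close>

definition near_integers :: "(int \<Rightarrow> real) \<Rightarrow> bool" where
  "near_integers lam \<longleftrightarrow> (\<forall>k. \<bar>lam k - of_int k\<bar> \<le> 1/2)"

text \<open>A generalised trigonometric polynomial whose frequencies are one per integer bin: bin b contributes
  the frequency b + p b.\<close>

definition trig :: "int \<Rightarrow> (int \<Rightarrow> real) \<Rightarrow> (int \<Rightarrow> complex) \<Rightarrow> real \<Rightarrow> complex" where
  "trig W p \<gamma> t = (\<Sum>b\<in>{-W..W}. \<gamma> b * cis ((of_int b + p b) * t))"

lemma near_integers_finite:
  assumes "near_integers lam" shows "finite {k. \<bar>lam k\<bar> < x}"
proof (rule finite_subset)
  show "{k. \<bar>lam k\<bar> < x} \<subseteq> {-\<lceil>x + 1\<rceil>..\<lceil>x + 1\<rceil>}"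
  proof
    fix k assume "k \<in> {k. \<bar>lam k\<bar> < x}"
    moreover have "\<bar>lam k - of_int k\<bar> \<le> 1/2" using assms by (simp add: near_integers_def)
    ultimately have "\<bar>real_of_int k\<bar> \<le> x + 1" unfolding mem_Collect_eq by linarith
    then show "k \<in> {-\<lceil>x + 1\<rceil>..\<lceil>x + 1\<rceil>}" by (simp add: abs_le_iff) linarith
  qed
qed simp

lemma psum_add: "psum lam (\<lambda>k. f k + g k) x t = psum lam f x t + psum lam g x t"
  by (simp add: psum_def distrib_right sum.distrib)

lemma psum_eq_0:
  assumes lam: "near_integers lam" and f: "\<And>k. f k \<noteq> 0 \<Longrightarrow> N < \<bar>k\<bar>" and x: "x \<le> of_int N"
  shows "psum lam f x t = 0"
  unfolding psum_def
proof (intro sum.neutral ballI)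
  fix k assume k: "k \<in> {k. \<bar>lam k\<bar> < x}"
  have "\<bar>lam k - of_int k\<bar> \<le> 1/2" using lam by (simp add: near_integers_def)
  with k x have "\<bar>real_of_int k\<bar> < of_int N + 1" unfolding mem_Collect_eq by linarith
  then have "\<bar>k\<bar> \<le> N" by linarith
  then show "f k * cis (lam k * t) = 0" using f[of k] by auto
qed

text \<open>Indices up to N have frequencies of modulus at most N + 1/2, so the strict cutoff at N +
  1 already catches all of them.\<close>

lemma psum_full:
  assumes lam: "near_integers lam" and f: "\<And>k. f k \<noteq> 0 \<Longrightarrow> \<bar>k\<bar> \<le> N" and x: "x \<ge> of_int N + 1"
  shows "psum lam f x t = psum lam f (of_int N + 1) t"
  unfolding psum_def
proof (rule sum.mono_neutral_right)
  show "finite {k. \<bar>lam k\<bar> < x}" by (rule near_integers_finite[OF lam])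
  show "{k. \<bar>lam k\<bar> < of_int N + 1} \<subseteq> {k. \<bar>lam k\<bar> < x}" using x by auto
  show "\<forall>k\<in>{k. \<bar>lam k\<bar> < x} - {k. \<bar>lam k\<bar> < of_int N + 1}. f k * cis (lam k * t) = 0"
  proof
    fix k assume k: "k \<in> {k. \<bar>lam k\<bar> < x} - {k. \<bar>lam k\<bar> < of_int N + 1}"
    have "\<bar>lam k - of_int k\<bar> \<le> 1/2" using lam by (simp add: near_integers_def)
    with k have "\<bar>real_of_int k\<bar> > of_int N" unfolding mem_Collect_eq Diff_iff by linarith
    then have "\<bar>k\<bar> > N" by linarith
    then show "f k * cis (lam k * t) = 0" using f[of k] by auto
  qed
qed

text \<open>Coefficients landing on the same index are added up, so the identity is a mere exchange
  of two sums.\<close>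

lemma psum_indexed:
  assumes lam: "near_integers lam" and I: "finite I"
  shows "psum lam (\<lambda>k. \<Sum>i\<in>I. if k = \<phi> i then g i else 0) x t
     = (\<Sum>i\<in>I. if \<bar>lam (\<phi> i)\<bar> < x then g i * cis (lam (\<phi> i) * t) else 0)"
proof -
  have "psum lam (\<lambda>k. \<Sum>i\<in>I. if k = \<phi> i then g i else 0) x t
     = (\<Sum>k\<in>{k. \<bar>lam k\<bar> < x}. \<Sum>i\<in>I. if k = \<phi> i then g i * cis (lam (\<phi> i) * t) else 0)"
    unfolding psum_def by (intro sum.cong refl) (auto simp: sum_distrib_right intro!: sum.cong)
  also have "\<dots> = (\<Sum>i\<in>I. \<Sum>k\<in>{k. \<bar>lam k\<bar> < x}. if k = \<phi> i then g i * cis (lam (\<phi> i) * t) else 0)"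
    by (rule sum.swap)
  also have "\<dots> = (\<Sum>i\<in>I. if \<bar>lam (\<phi> i)\<bar> < x then g i * cis (lam (\<phi> i) * t) else 0)"
    using near_integers_finite[OF lam] by (intro sum.cong refl) (simp add: sum.delta)
  finally show ?thesis .
qed

section \<open>Blocks of frequencies\<close>

lemma norm_cis_diff_le: "norm (cis a - cis b) \<le> \<bar>a - b\<bar>"
proof -
  have "cis a - cis b = cis b * (cis (a - b) - 1)" by (simp add: algebra_simps cis_mult)
  then have "norm (cis a - cis b) = norm (cis (a - b) - 1)" by (simp add: norm_mult)
  also have "\<dots> = 2 * \<bar>sin ((a - b) / 2)\<bar>" using dist_exp_i_1[of "a - b"] by (simp add: cis_conv_exp)
  also have "\<dots> \<le> \<bar>a - b\<bar>" using abs_sin_x_le_abs_x[of "(a - b) / 2"] by simp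
  finally show ?thesis .
qed

text \<open>Around each mN the spectrum imitates the bins b + p b. The value m = 0 is left out
  because the block around 0 does not move with N; accordingly the kernel has no constant
  term.\<close>

definition pattern_recurs :: "(int \<Rightarrow> real) \<Rightarrow> int \<Rightarrow> (int \<Rightarrow> real) \<Rightarrow> bool" where
  "pattern_recurs lam W p \<longleftrightarrow> (\<forall>M N0 \<eta>. \<eta> > 0 \<longrightarrow>
     (\<exists>N>N0. \<forall>m b. 0 < \<bar>m\<bar> \<longrightarrow> \<bar>m\<bar> \<le> M \<longrightarrow> \<bar>b\<bar> \<le> W \<longrightarrow>
        \<bar>lam (m * N + b) - (of_int (m * N + b) + p b)\<bar> \<le> \<eta>))"

text \<open>The product s G(t) D(Nt), with G = \<open>trig W p \<gamma>\<close>, has the frequencies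
  mN + b + p b, and recurrence of the pattern lets lam (mN + b) replace them. A cutoff x contains
  some complete blocks, which are controlled by the partial sums of the kernel and thus by |G(t)|,
  and cuts through at most the two blocks of the next m, which cost the crude 2 s B.\<close>

lemma trig_mult_kernel_block:
  fixes lam p :: "int \<Rightarrow> real" and \<gamma> :: "int \<Rightarrow> complex" and W N0 :: int and A c \<eta> s :: real
  assumes lam: "near_integers lam" and W: "W \<ge> 0"
    and match: "pattern_recurs lam W p"
    and A: "A \<ge> 0" and c: "c > 0" and \<eta>: "\<eta> > 0" and s: "s \<ge> 0"
  defines "B \<equiv> \<Sum>b\<in>{-W..W}. norm (\<gamma> b)"
  shows "\<exists>f N1 N. N \<ge> 1 \<and> N0 \<le> N1 \<and> (\<forall>k. f k \<noteq> 0 \<longrightarrow> N0 < \<bar>k\<bar> \<and> \<bar>k\<bar> \<le> N1) \<and>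
     (\<forall>t. \<bar>t\<bar> \<le> A \<longrightarrow> c \<le> norm (1 - cis (of_int N * t)) \<longrightarrow>
        norm (psum lam f (of_int N1 + 1) t - of_real s * trig W p \<gamma> t) \<le> \<eta> \<and>
        (\<forall>x. norm (psum lam f x t) \<le> s * (8 / c) * norm (trig W p \<gamma> t) + 2 * s * B + \<eta>))"
proof -
  have B: "B \<ge> 0" by (simp add: B_def sum_nonneg)
  have sB: "s * B \<ge> 0" using s B by simp
  \<comment> \<open>The kernel error \<open>\<eta>1\<close> is multiplied by at most s B. The added
    1 only keeps the denominator positive.\<close>
  define \<eta>1 where "\<eta>1 = \<eta> / (2 * (s * B + 1))"
  have \<eta>1: "\<eta>1 > 0" using \<eta> sB by (simp add: \<eta>1_def)
  obtain M :: nat and a :: "nat \<Rightarrow> real" where a1: "\<And>n. \<bar>a n\<bar> \<le> 1"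
    and ker: "\<And>u. c \<le> norm (1 - cis u) \<Longrightarrow>
       norm ((\<Sum>m\<in>{-int M..int M}-{0}. of_real (a (nat \<bar>m\<bar>)) * cis (of_int m * u)) - 1) \<le> \<eta>1"
    and kerb: "\<And>u J. c \<le> norm (1 - cis u) \<Longrightarrow> J \<le> M \<Longrightarrow>
       norm (\<Sum>m\<in>{-int J..int J}-{0}. of_real (a (nat \<bar>m\<bar>)) * cis (of_int m * u)) \<le> 8 / c"
    using damped_geometric_kernel[OF c \<eta>1] by (elim exE conjE) blast
  define Z where "Z = (2 * real M + 1) * (s * B * A)"
  have Z: "Z \<ge> 0" using sB A by (simp add: Z_def)
  \<comment> \<open>For |t| \<le> A a frequency mismatch of \<open>\<eta>2\<close> costs at most s B
    A \<eta>2 per block, and there are at most 2M + 1 blocks.\<close>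
  define \<eta>2 where "\<eta>2 = \<eta> / (2 * (Z + 1))"
  have \<eta>2: "\<eta>2 > 0" using \<eta> Z by (simp add: \<eta>2_def)
  have \<eta>2': "(2 * real M + 1) * (s * B * (A * \<eta>2)) \<le> \<eta> / 2"
  proof -
    have "(2 * real M + 1) * (s * B * (A * \<eta>2)) = Z * \<eta>2" by (simp add: Z_def)
    also have "\<dots> \<le> (Z + 1) * \<eta>2" using \<eta>2 by (intro mult_right_mono) auto
    also have "\<dots> = \<eta> / 2" using Z by (simp add: \<eta>2_def field_simps)
    finally show ?thesis .
  qed
  have \<eta>1': "s * B * \<eta>1 \<le> \<eta> / 2"
  proof -
    have "s * B * \<eta>1 \<le> (s * B + 1) * \<eta>1" using \<eta>1 by (intro mult_right_mono) auto
    also have "\<dots> = \<eta> / 2" using sB unfolding \<eta>1_def by (simp add: field_simps)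
    finally show ?thesis .
  qed
  \<comment> \<open>This size of N pushes all blocks beyond N0 and keeps consecutive blocks, each of
    radius W, more than two units apart.\<close>
  obtain N where N: "N > \<bar>N0\<bar> + 2 * W + 2"
    and mat: "\<And>m b. 0 < \<bar>m\<bar> \<Longrightarrow> \<bar>m\<bar> \<le> int M \<Longrightarrow> \<bar>b\<bar> \<le> W \<Longrightarrow>
                  \<bar>lam (m * N + b) - (of_int (m * N + b) + p b)\<bar> \<le> \<eta>2"
    using match[unfolded pattern_recurs_def, rule_format, OF \<eta>2, of "\<bar>N0\<bar> + 2 * W + 2" "int M"]
    by (elim exE conjE) blast
  define I where "I = ({-int M..int M}-{0}) \<times> {-W..W}"
  define \<phi> where "\<phi> = (\<lambda>(m, b). m * N + b)"
  define g where "g = (\<lambda>(m, b). of_real (s * a (nat \<bar>m\<bar>)) * \<gamma> b)"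
  define f where "f = (\<lambda>k. \<Sum>i\<in>I. if k = \<phi> i then g i else 0)"
  \<comment> \<open>The summand |N0| ensures N0 \<le> N1 also when M = 0 and there are no blocks at
    all.\<close>
  define N1 where "N1 = int M * N + W + \<bar>N0\<bar>"
  have absN: "\<bar>m * N\<bar> = \<bar>m\<bar> * N" for m using N W by (simp add: abs_mult)
  have supp: "N0 < \<bar>k\<bar> \<and> \<bar>k\<bar> \<le> N1" if "f k \<noteq> 0" for k
  proof -
    have "\<exists>i\<in>I. k = \<phi> i"
    proof (rule ccontr)
      assume "\<not> ?thesis"
      then have "f k = 0" unfolding f_def by (intro sum.neutral) auto
      with that show False by simp
    qed
    then obtain i where "i \<in> I" "k = \<phi> i" by blast
    moreover obtain m b where "i = (m, b)" by (cases i)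
    ultimately have mb: "m \<in> {-int M..int M}-{0}" "b \<in> {-W..W}" "k = m * N + b"
      by (simp_all add: I_def \<phi>_def)
    have "1 * N \<le> \<bar>m\<bar> * N" using mb N W by (intro mult_right_mono) auto
    moreover have "\<bar>m\<bar> * N \<le> int M * N" using mb N W by (intro mult_right_mono) auto
    ultimately show ?thesis using mb(2,3) N W absN[of m] unfolding N1_def by auto
  qed
  have main: "norm (psum lam f (of_int N1 + 1) t - of_real s * trig W p \<gamma> t) \<le> \<eta> \<and>
        (\<forall>x. norm (psum lam f x t) \<le> s * (8 / c) * norm (trig W p \<gamma> t) + 2 * s * B + \<eta>)"
    if t: "\<bar>t\<bar> \<le> A" and u: "c \<le> norm (1 - cis (of_int N * t))" for t
  proof -
    define G where "G = trig W p \<gamma> t"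
    have GB: "norm G \<le> B" unfolding G_def trig_def B_def by (intro sum_norm_le) (simp add: norm_mult)
    define S where "S = (\<lambda>J. \<Sum>m\<in>{-int J..int J}-{0}. of_real (a (nat \<bar>m\<bar>)) * cis (of_int m * (of_int N * t)))"
    \<comment> \<open>J counts the blocks that lie completely below the cutoff x. The extra term
      accounts for the blocks m = J + 1 and m = -J - 1, which may be cut; none are left once J =
      M.\<close>
    have *: "\<exists>J\<le>M. (of_int N1 + 1 \<le> x \<longrightarrow> J = M) \<and>
       norm (psum lam f x t - of_real s * G * S J) \<le> \<eta> / 2 + (if J < M then 2 * (s * B) else 0)" for x
    proof -
      \<comment> \<open>All frequencies of the blocks |m| \<le> j have modulus at most jN + W + 1/2,
        hence lie below x when jN + W + 1 \<le> x. Admitting j = 0 unconditionally makes the maximum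
        exist.\<close>
      define P where "P = {j. j \<le> M \<and> (j = 0 \<or> real_of_int (int j * N + W + 1) \<le> x)}"
      define J where "J = Max P"
      have P: "finite P" "P \<noteq> {}" by (auto simp: P_def)
      have "J \<in> P" unfolding J_def by (rule Max_in[OF P])
      then have JM: "J \<le> M" and J0: "J = 0 \<or> real_of_int (int J * N + W + 1) \<le> x" by (auto simp: P_def)
      have JS: "x < real_of_int (int j * N + W + 1)" if "j \<le> M" "J < j" for j
      proof (rule ccontr)
        assume "\<not> ?thesis" then have "j \<in> P" using that by (simp add: P_def)
        then have "j \<le> J" unfolding J_def by (rule Max_ge[OF P(1)])
        with that show False by simp
      qed
      have full: "J = M" if "of_int N1 + 1 \<le> x"
      proof -
        have "real_of_int (int M * N + W + 1) \<le> real_of_int N1 + 1" by (simp add: N1_def)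
        then show ?thesis using that JS[of M] JM by linarith
      qed
      define h where "h = (\<lambda>m. \<Sum>b\<in>{-W..W}. if \<bar>lam (m * N + b)\<bar> < x
           then of_real (s * a (nat \<bar>m\<bar>)) * \<gamma> b * cis (lam (m * N + b) * t) else 0)"
      define i where "i = (\<lambda>m::int. of_real s * G * (of_real (a (nat \<bar>m\<bar>)) * cis (of_int m * (of_int N * t))))"
      have "psum lam f x t = (\<Sum>j\<in>I. if \<bar>lam (\<phi> j)\<bar> < x then g j * cis (lam (\<phi> j) * t) else 0)"
        unfolding f_def by (rule psum_indexed[OF lam]) (simp add: I_def)
      also have "\<dots> = (\<Sum>m\<in>{-int M..int M}-{0}. h m)"
        unfolding I_def h_def by (subst sum.cartesian_product) (simp add: \<phi>_def g_def case_prod_beta cong: if_cong)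
      finally have ps: "psum lam f x t = (\<Sum>m\<in>{-int M..int M}-{0}. h m)" .
      have "of_real s * G * S J = (\<Sum>m\<in>{-int J..int J}-{0}. i m)"
        unfolding S_def i_def by (rule sum_distrib_left)
      also have "\<dots> = (\<Sum>m\<in>{-int M..int M}-{0}. if \<bar>m\<bar> \<le> int J then i m else 0)"
        using JM by (intro sum.mono_neutral_cong_left) auto
      finally have si: "of_real s * G * S J = (\<Sum>m\<in>{-int M..int M}-{0}. if \<bar>m\<bar> \<le> int J then i m else 0)" .
      \<comment> \<open>Error per block: a complete block suffers only from the mismatch of
        frequencies, a block next in line counts in full, and blocks further out do not
        occur.\<close>
      define bd where "bd = (\<lambda>m. (if \<bar>m\<bar> \<le> int J then s * B * (A * \<eta>2) else 0) + (if \<bar>m\<bar> = int J + 1 then s * B else 0))"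
      have bound: "norm (h m - (if \<bar>m\<bar> \<le> int J then i m else 0)) \<le> bd m" if m: "m \<in> {-int M..int M}-{0}" for m
      proof -
        have lamk: "\<bar>lam k\<bar> \<le> \<bar>of_int k\<bar> + 1/2" "\<bar>of_int k\<bar> - 1/2 \<le> \<bar>lam k\<bar>" for k
        proof -
          have "\<bar>lam k - of_int k\<bar> \<le> 1/2" using lam by (simp add: near_integers_def)
          then show "\<bar>lam k\<bar> \<le> \<bar>of_int k\<bar> + 1/2" "\<bar>of_int k\<bar> - 1/2 \<le> \<bar>lam k\<bar>" by linarith+
        qed
        have sa: "norm (of_real (s * a n) * z) \<le> s * norm z" for n and z :: complex
        proof -
          have "norm (of_real (s * a n) * z) = \<bar>a n\<bar> * (s * norm z)" using s by (simp add: norm_mult abs_mult)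
          also have "\<dots> \<le> 1 * (s * norm z)" using a1[of n] s by (intro mult_right_mono) auto
          finally show ?thesis by simp
        qed
        consider "\<bar>m\<bar> \<le> int J" | "\<bar>m\<bar> = int J + 1" | "\<bar>m\<bar> \<ge> int J + 2" by linarith
        then show ?thesis
        proof cases
          case 1
          then have x: "real_of_int (int J * N + W + 1) \<le> x" using J0 m by auto
          have lx: "\<bar>lam (m * N + b)\<bar> < x" if "b \<in> {-W..W}" for b
          proof -
            have "\<bar>m\<bar> * N \<le> int J * N" using 1 N W by (intro mult_right_mono) auto
            then have "\<bar>m * N + b\<bar> \<le> int J * N + W" using absN[of m] that by auto
            then have "\<bar>real_of_int (m * N + b)\<bar> \<le> real_of_int (int J * N + W)" by linarith
            then show ?thesis using lamk(1)[of "m * N + b"] x by (simp add: algebra_simps)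
          qed
          have "h m = (\<Sum>b\<in>{-W..W}. of_real (s * a (nat \<bar>m\<bar>)) * (\<gamma> b * cis (lam (m * N + b) * t)))"
            unfolding h_def using lx by (intro sum.cong) (auto simp: mult.assoc)
          moreover have "i m = (\<Sum>b\<in>{-W..W}. of_real (s * a (nat \<bar>m\<bar>)) * (\<gamma> b * cis ((of_int (m * N + b) + p b) * t)))"
            unfolding i_def G_def trig_def
          proof -
            have "cis ((of_int (m * N + b) + p b) * t) = cis ((of_int b + p b) * t) * cis (of_int m * (of_int N * t))" for b
              by (simp add: cis_mult algebra_simps)
            then show "of_real s * (\<Sum>b\<in>{-W..W}. \<gamma> b * cis ((of_int b + p b) * t)) * (of_real (a (nat \<bar>m\<bar>)) * cis (of_int m * (of_int N * t)))
              = (\<Sum>b\<in>{-W..W}. of_real (s * a (nat \<bar>m\<bar>)) * (\<gamma> b * cis ((of_int (m * N + b) + p b) * t)))"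
              by (simp add: sum_distrib_left sum_distrib_right mult_ac)
          qed
          ultimately have "h m - i m = (\<Sum>b\<in>{-W..W}. of_real (s * a (nat \<bar>m\<bar>)) *
              (\<gamma> b * (cis (lam (m * N + b) * t) - cis ((of_int (m * N + b) + p b) * t))))"
            by (simp add: sum_subtractf[symmetric] right_diff_distrib)
          also have "norm \<dots> \<le> (\<Sum>b\<in>{-W..W}. s * (norm (\<gamma> b) * (A * \<eta>2)))"
          proof (rule sum_norm_le)
            fix b assume b: "b \<in> {-W..W}"
            have "norm (cis (lam (m * N + b) * t) - cis ((of_int (m * N + b) + p b) * t))
               \<le> \<bar>lam (m * N + b) * t - (of_int (m * N + b) + p b) * t\<bar>" by (rule norm_cis_diff_le)
            also have "\<dots> = \<bar>t\<bar> * \<bar>lam (m * N + b) - (of_int (m * N + b) + p b)\<bar>"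
              by (simp add: abs_mult[symmetric] right_diff_distrib mult.commute)
            also have "\<dots> \<le> A * \<eta>2" using t mat[of m b] m b A by (intro mult_mono) auto
            finally have "norm (\<gamma> b * (cis (lam (m * N + b) * t) - cis ((of_int (m * N + b) + p b) * t)))
              \<le> norm (\<gamma> b) * (A * \<eta>2)" unfolding norm_mult by (intro mult_left_mono) auto
            then show "norm (of_real (s * a (nat \<bar>m\<bar>)) *
              (\<gamma> b * (cis (lam (m * N + b) * t) - cis ((of_int (m * N + b) + p b) * t)))) \<le> s * (norm (\<gamma> b) * (A * \<eta>2))"
              using s by (intro order_trans[OF sa] mult_left_mono)
          qed
          also have "\<dots> = s * B * (A * \<eta>2)"
            by (simp add: B_def sum_distrib_left sum_distrib_right mult.assoc)
          finally show ?thesis using 1 by (simp add: bd_def)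
        next
          case 2
          have "norm (h m) \<le> (\<Sum>b\<in>{-W..W}. s * norm (\<gamma> b))"
            unfolding h_def
          proof (rule sum_norm_le)
            fix b
            have "norm (of_real (s * a (nat \<bar>m\<bar>)) * (\<gamma> b * cis (lam (m * N + b) * t))) \<le> s * norm (\<gamma> b * cis (lam (m * N + b) * t))"
              by (rule sa)
            then show "norm (if \<bar>lam (m * N + b)\<bar> < x then of_real (s * a (nat \<bar>m\<bar>)) * \<gamma> b * cis (lam (m * N + b) * t) else 0) \<le> s * norm (\<gamma> b)"
              using s by (simp add: norm_mult mult.assoc)
          qed
          also have "\<dots> = s * B" by (simp add: B_def sum_distrib_left)
          finally show ?thesis using 2 by (simp add: bd_def)
        next
          case 3
          \<comment> \<open>By maximality of J the cutoff lies below the upper end of block J + 1,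
            and the gap between blocks puts it below all of block J + 2.\<close>
          have x: "x < real_of_int (int (J + 1) * N + W + 1)" using 3 m by (intro JS) auto
          have "\<not> \<bar>lam (m * N + b)\<bar> < x" if "b \<in> {-W..W}" for b
          proof -
            have "(int J + 2) * N \<le> \<bar>m\<bar> * N" using 3 N W by (intro mult_right_mono) auto
            then have "(int J + 1) * N + N - W \<le> \<bar>m * N + b\<bar>" using absN[of m] that by (auto simp: algebra_simps)
            then have "int (J + 1) * N + W + 2 \<le> \<bar>m * N + b\<bar>" using N by (simp add: add.commute)
            then have "real_of_int (int (J + 1) * N + W + 2) \<le> \<bar>real_of_int (m * N + b)\<bar>" by linarith
            then show ?thesis using lamk(2)[of "m * N + b"] x by (simp add: algebra_simps)
          qed
          then have "h m = 0" unfolding h_def by (intro sum.neutral) auto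
          then show ?thesis using 3 by (simp add: bd_def)
        qed
      qed
      have "psum lam f x t - of_real s * G * S J = (\<Sum>m\<in>{-int M..int M}-{0}. h m - (if \<bar>m\<bar> \<le> int J then i m else 0))"
        unfolding ps si by (simp add: sum_subtractf)
      also have "norm \<dots> \<le> sum bd ({-int M..int M}-{0})" by (rule sum_norm_le[OF bound])
      also have "\<dots> = (\<Sum>m\<in>{-int M..int M}-{0}. if \<bar>m\<bar> \<le> int J then s * B * (A * \<eta>2) else 0)
          + (\<Sum>m\<in>{-int M..int M}-{0}. if \<bar>m\<bar> = int J + 1 then s * B else 0)"
        unfolding bd_def by (rule sum.distrib)
      also have "(\<Sum>m\<in>{-int M..int M}-{0}. if \<bar>m\<bar> \<le> int J then s * B * (A * \<eta>2) else 0) \<le> \<eta> / 2"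
      proof -
        have "0 \<le> s * B * (A * \<eta>2)" using sB A \<eta>2 by simp
        then have "(\<Sum>m\<in>{-int M..int M}-{0}. if \<bar>m\<bar> \<le> int J then s * B * (A * \<eta>2) else 0)
           \<le> (\<Sum>m\<in>{-int M..int M}. s * B * (A * \<eta>2))"
          by (intro order_trans[OF sum_mono sum_mono2]) auto
        also have "\<dots> = (2 * real M + 1) * (s * B * (A * \<eta>2))" by simp
        finally show ?thesis using \<eta>2' by linarith
      qed
      also have "(\<Sum>m\<in>{-int M..int M}-{0}. if \<bar>m\<bar> = int J + 1 then s * B else 0) \<le> (if J < M then 2 * (s * B) else 0)"
      proof (cases "J < M")
        case True
        have "(\<Sum>m\<in>{-int M..int M}-{0}. if \<bar>m\<bar> = int J + 1 then s * B else 0)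
          = (\<Sum>m\<in>({-int M..int M}-{0}) \<inter> {m. \<bar>m\<bar> = int J + 1}. s * B)"
          by (subst sum.inter_restrict) auto
        also have "\<dots> \<le> (\<Sum>m\<in>{int J + 1, - int J - 1}. s * B)"
          using sB by (intro sum_mono2) auto
        also have "\<dots> = 2 * (s * B)" by simp
        finally show ?thesis using True by simp
      next
        case False
        then have "(\<Sum>m\<in>{-int M..int M}-{0}. if \<bar>m\<bar> = int J + 1 then s * B else 0) = 0"
          by (intro sum.neutral) auto
        then show ?thesis using False by simp
      qed
      finally show ?thesis using JM full by (intro exI[of _ J]) auto
    qed
    have "norm (psum lam f (of_int N1 + 1) t - of_real s * G * S M) \<le> \<eta> / 2"
      using *[of "of_int N1 + 1"] by auto
    moreover have "norm (of_real s * G * S M - of_real s * G) \<le> \<eta> / 2"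
    proof -
      have "of_real s * G * S M - of_real s * G = of_real s * G * (S M - 1)" by (simp add: algebra_simps)
      also have "norm \<dots> = s * norm G * norm (S M - 1)" using s by (simp add: norm_mult)
      also have "\<dots> \<le> s * B * \<eta>1" using ker[OF u] s GB B unfolding S_def by (intro mult_mono) auto
      finally show ?thesis using \<eta>1' by linarith
    qed
    ultimately have "norm (psum lam f (of_int N1 + 1) t - of_real s * G) \<le> \<eta>"
      using norm_triangle_ineq[of "psum lam f (of_int N1 + 1) t - of_real s * G * S M" "of_real s * G * S M - of_real s * G"]
      by simp
    moreover have "norm (psum lam f x t) \<le> s * (8 / c) * norm G + 2 * s * B + \<eta>" for x
    proof -
      obtain J where J: "J \<le> M"
        "norm (psum lam f x t - of_real s * G * S J) \<le> \<eta> / 2 + (if J < M then 2 * (s * B) else 0)"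
        using * by blast
      have "norm (of_real s * G * S J) = s * norm G * norm (S J)" using s by (simp add: norm_mult)
      also have "\<dots> \<le> s * norm G * (8 / c)"
        using kerb[OF u J(1)] s unfolding S_def by (intro mult_left_mono) auto
      finally have "norm (of_real s * G * S J) \<le> s * (8 / c) * norm G" by (simp add: mult_ac)
      moreover have "(if J < M then 2 * (s * B) else 0) \<le> 2 * s * B" using sB by (simp add: mult.commute)
      moreover have "norm (psum lam f x t) \<le> norm (psum lam f x t - of_real s * G * S J) + norm (of_real s * G * S J)"
        using norm_triangle_sub[of "psum lam f x t" "of_real s * G * S J"] by linarith
      ultimately show ?thesis using J(2) \<eta> by linarith
    qed
    ultimately show ?thesis unfolding G_def by blast
  qed
  have "N \<ge> 1" using N W by linarith
  moreover have "N0 \<le> N1"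
  proof -
    have "0 \<le> int M * N" using N W by simp
    then show ?thesis unfolding N1_def using W by linarith
  qed
  ultimately show ?thesis using supp main by blast
qed

section \<open>Approximation in measure with one frequency per bin\<close>

text \<open>The freedom to avoid all bins up to an arbitrary \<open>N0\<close> is what makes the
  property additive: approximants of two summands can be given disjoint sets of bins.\<close>

definition bin_approximable :: "(real \<Rightarrow> complex) \<Rightarrow> bool" where
  "bin_approximable g \<longleftrightarrow> (\<forall>A \<epsilon> \<eta> N0. A \<ge> 0 \<longrightarrow> \<epsilon> > 0 \<longrightarrow> \<eta> > 0 \<longrightarrow>
     (\<exists>W p \<gamma> E. 0 \<le> W \<and> N0 \<le> W \<and> (\<forall>b. \<bar>p b\<bar> \<le> 1/2) \<and> (\<forall>b. \<gamma> b \<noteq> 0 \<longrightarrow> N0 < \<bar>b\<bar> \<and> \<bar>b\<bar> \<le> W) \<and>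
        E \<in> lmeasurable \<and> measure lebesgue E \<le> \<epsilon> \<and>
        (\<forall>t. \<bar>t\<bar> \<le> A \<longrightarrow> t \<notin> E \<longrightarrow> norm (trig W p \<gamma> t - g t) \<le> \<eta>)))"

text \<open>The block construction is applied to the auxiliary spectrum k + p0, where p0 is the
  offset of \<theta> from its nearest integer. The constant pattern p0 recurs there exactly, and
  multiplication by D(Nt) moves the single frequency \<theta> into far bins.\<close>

lemma bin_approximable_exp: "bin_approximable (\<lambda>t. z * cis (\<theta> * t))"
  unfolding bin_approximable_def
proof (intro allI impI)
  fix A \<epsilon> \<eta> :: real and N0 :: int
  assume A: "A \<ge> 0" and \<epsilon>: "\<epsilon> > 0" and \<eta>: "\<eta> > 0"
  define p0 where "p0 = \<theta> - of_int (round \<theta>)"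
  define lam where "lam = (\<lambda>k::int. of_int k + p0)"
  define W where "W = \<bar>round \<theta>\<bar>"
  define \<gamma> where "\<gamma> = (\<lambda>b. if b = round \<theta> then z else 0)"
  define c where "c = \<epsilon> / (2 * A + 12)"
  have c: "c > 0" using A \<epsilon> by (simp add: c_def)
  have p0: "\<bar>p0\<bar> \<le> 1/2" using of_int_round_abs_le[of \<theta>] unfolding p0_def by linarith
  then have lam: "near_integers lam" by (simp add: near_integers_def lam_def)
  have tr: "trig W (\<lambda>_. p0) \<gamma> t = z * cis (\<theta> * t)" for t
  proof -
    have "trig W (\<lambda>_. p0) \<gamma> t = (\<Sum>b\<in>{-W..W}. if b = round \<theta> then z * cis (\<theta> * t) else 0)"
      unfolding trig_def \<gamma>_def by (intro sum.cong) (auto simp: p0_def)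
    also have "\<dots> = z * cis (\<theta> * t)" by (subst sum.delta) (auto simp: W_def)
    finally show ?thesis .
  qed
  have match: "pattern_recurs lam W (\<lambda>_. p0)"
    unfolding pattern_recurs_def
  proof (intro allI impI)
    fix M N0 :: int and \<eta> :: real assume "\<eta> > 0"
    then show "\<exists>N>N0. \<forall>m b. 0 < \<bar>m\<bar> \<longrightarrow> \<bar>m\<bar> \<le> M \<longrightarrow> \<bar>b\<bar> \<le> W \<longrightarrow>
        \<bar>lam (m * N + b) - (of_int (m * N + b) + p0)\<bar> \<le> \<eta>"
      by (intro exI[of _ "N0 + 1"]) (simp add: lam_def)
  qed
  have W0: "0 \<le> W" by (simp add: W_def)
  \<comment> \<open>Using |N0| instead of N0 also yields N1 \<ge> 0, so that N1 can serve as the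
    window radius.\<close>
  obtain f N1 N where N: "N \<ge> 1" and N1: "\<bar>N0\<bar> \<le> N1" and supp: "\<And>k. f k \<noteq> 0 \<Longrightarrow> \<bar>N0\<bar> < \<bar>k\<bar> \<and> \<bar>k\<bar> \<le> N1"
    and app: "\<And>t. \<bar>t\<bar> \<le> A \<Longrightarrow> c \<le> norm (1 - cis (of_int N * t)) \<Longrightarrow>
        norm (psum lam f (of_int N1 + 1) t - of_real 1 * trig W (\<lambda>_. p0) \<gamma> t) \<le> \<eta>"
    using trig_mult_kernel_block[OF lam W0 match A c \<eta> zero_le_one, where ?N0.0 = "\<bar>N0\<bar>" and \<gamma> = \<gamma>]
    by (elim exE conjE) blast
  have ps: "psum lam f (of_int N1 + 1) t = trig N1 (\<lambda>_. p0) f t" for t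
    unfolding psum_def trig_def
  proof (rule sum.mono_neutral_cong_right)
    show "finite {k. \<bar>lam k\<bar> < of_int N1 + 1}" by (rule near_integers_finite[OF lam])
    show "{-N1..N1} \<subseteq> {k. \<bar>lam k\<bar> < of_int N1 + 1}"
    proof
      fix k assume "k \<in> {-N1..N1}"
      then have "\<bar>k\<bar> \<le> N1" by auto
      then have "\<bar>real_of_int k\<bar> \<le> of_int N1" by linarith
      then have "\<bar>lam k\<bar> < of_int N1 + 1" using p0 unfolding lam_def by linarith
      then show "k \<in> {k. \<bar>lam k\<bar> < of_int N1 + 1}" by simp
    qed
    show "\<forall>i\<in>{k. \<bar>lam k\<bar> < of_int N1 + 1} - {-N1..N1}. f i * cis (lam i * t) = 0"
    proof
      fix k assume "k \<in> {k. \<bar>lam k\<bar> < of_int N1 + 1} - {-N1..N1}"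
      then have "\<not> \<bar>k\<bar> \<le> N1" by auto
      then have "f k = 0" using supp by blast
      then show "f k * cis (lam k * t) = 0" by simp
    qed
    show "f k * cis (lam k * t) = f k * cis ((of_int k + p0) * t)" for k by (simp add: lam_def)
  qed
  define E where "E = {t \<in> {-A..A}. norm (1 - cis (of_int N * t)) < c}"
  have "(2 * A + 12) * c = \<epsilon>" using A by (simp add: c_def)
  then have E: "E \<in> lmeasurable" "measure lebesgue E \<le> \<epsilon>"
    using measure_cis_near_one[OF A c N, folded E_def] by simp_all
  have "norm (trig N1 (\<lambda>_. p0) f t - z * cis (\<theta> * t)) \<le> \<eta>" if "\<bar>t\<bar> \<le> A" "t \<notin> E" for t
    using app[of t] that unfolding ps tr by (simp add: E_def abs_le_iff not_less)
  then show "\<exists>W p \<gamma> E. 0 \<le> W \<and> N0 \<le> W \<and> (\<forall>b. \<bar>p b\<bar> \<le> 1/2) \<and> (\<forall>b. \<gamma> b \<noteq> 0 \<longrightarrow> N0 < \<bar>b\<bar> \<and> \<bar>b\<bar> \<le> W) \<and>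
        E \<in> lmeasurable \<and> measure lebesgue E \<le> \<epsilon> \<and>
        (\<forall>t. \<bar>t\<bar> \<le> A \<longrightarrow> t \<notin> E \<longrightarrow> norm (trig W p \<gamma> t - z * cis (\<theta> * t)) \<le> \<eta>)"
    using N1 p0 E
    by (intro exI[of _ N1] exI[of _ "\<lambda>_. p0"] exI[of _ f] exI[of _ E] conjI allI impI) (auto dest: supp)
qed

lemma trig_disjoint_add:
  assumes "W1 \<le> W2" and "\<And>b. \<gamma>1 b \<noteq> 0 \<Longrightarrow> \<bar>b\<bar> \<le> W1" and "\<And>b. \<gamma>2 b \<noteq> 0 \<Longrightarrow> W1 < \<bar>b\<bar>"
  shows "trig W2 (\<lambda>b. if \<bar>b\<bar> \<le> W1 then p1 b else p2 b) (\<lambda>b. \<gamma>1 b + \<gamma>2 b) t = trig W1 p1 \<gamma>1 t + trig W2 p2 \<gamma>2 t"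
proof -
  have "trig W1 p1 \<gamma>1 t = (\<Sum>b\<in>{-W2..W2}. if \<bar>b\<bar> \<le> W1 then \<gamma>1 b * cis ((of_int b + p1 b) * t) else 0)"
    unfolding trig_def using assms(1) by (intro sum.mono_neutral_cong_left) auto
  then have "trig W1 p1 \<gamma>1 t + trig W2 p2 \<gamma>2 t = (\<Sum>b\<in>{-W2..W2}.
      (if \<bar>b\<bar> \<le> W1 then \<gamma>1 b * cis ((of_int b + p1 b) * t) else 0) + \<gamma>2 b * cis ((of_int b + p2 b) * t))"
    by (simp add: trig_def sum.distrib)
  also have "\<dots> = trig W2 (\<lambda>b. if \<bar>b\<bar> \<le> W1 then p1 b else p2 b) (\<lambda>b. \<gamma>1 b + \<gamma>2 b) t"
    unfolding trig_def
  proof (rule sum.cong)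
    fix b
    show "(if \<bar>b\<bar> \<le> W1 then \<gamma>1 b * cis ((of_int b + p1 b) * t) else 0) + \<gamma>2 b * cis ((of_int b + p2 b) * t)
      = (\<gamma>1 b + \<gamma>2 b) * cis ((of_int b + (if \<bar>b\<bar> \<le> W1 then p1 b else p2 b)) * t)"
      using assms(2)[of b] assms(3)[of b] by (cases "\<bar>b\<bar> \<le> W1"; cases "\<gamma>1 b = 0"; cases "\<gamma>2 b = 0") auto
  qed simp
  finally show ?thesis by simp
qed

text \<open>The second function is approximated only after the first, with all bins up to W1
  forbidden.\<close>

lemma bin_approximable_add:
  assumes g: "bin_approximable g" and h: "bin_approximable h"
  shows "bin_approximable (\<lambda>t. g t + h t)"
  unfolding bin_approximable_def
proof (intro allI impI)
  fix A \<epsilon> \<eta> :: real and N0 :: int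
  assume A: "A \<ge> 0" and \<epsilon>: "\<epsilon> > 0" and \<eta>: "\<eta> > 0"
  have \<epsilon>2: "\<epsilon> / 2 > 0" and \<eta>2: "\<eta> / 2 > 0" using \<epsilon> \<eta> by auto
  obtain W1 p1 \<gamma>1 E1 where 1: "0 \<le> W1" "N0 \<le> W1" "\<And>b. \<bar>p1 b\<bar> \<le> 1/2" "\<And>b. \<gamma>1 b \<noteq> 0 \<Longrightarrow> N0 < \<bar>b\<bar> \<and> \<bar>b\<bar> \<le> W1"
      "E1 \<in> lmeasurable" "measure lebesgue E1 \<le> \<epsilon> / 2" "\<And>t. \<bar>t\<bar> \<le> A \<Longrightarrow> t \<notin> E1 \<Longrightarrow> norm (trig W1 p1 \<gamma>1 t - g t) \<le> \<eta> / 2"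
    using g[unfolded bin_approximable_def, rule_format, OF A \<epsilon>2 \<eta>2, of N0] by (elim exE conjE) blast
  obtain W2 p2 \<gamma>2 E2 where 2: "0 \<le> W2" "W1 \<le> W2" "\<And>b. \<bar>p2 b\<bar> \<le> 1/2" "\<And>b. \<gamma>2 b \<noteq> 0 \<Longrightarrow> W1 < \<bar>b\<bar> \<and> \<bar>b\<bar> \<le> W2"
      "E2 \<in> lmeasurable" "measure lebesgue E2 \<le> \<epsilon> / 2" "\<And>t. \<bar>t\<bar> \<le> A \<Longrightarrow> t \<notin> E2 \<Longrightarrow> norm (trig W2 p2 \<gamma>2 t - h t) \<le> \<eta> / 2"
    using h[unfolded bin_approximable_def, rule_format, OF A \<epsilon>2 \<eta>2, of W1] by (elim exE conjE) blast
  define p where "p = (\<lambda>b. if \<bar>b\<bar> \<le> W1 then p1 b else p2 b)"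
  define \<gamma> where "\<gamma> = (\<lambda>b. \<gamma>1 b + \<gamma>2 b)"
  have tr: "trig W2 p \<gamma> t = trig W1 p1 \<gamma>1 t + trig W2 p2 \<gamma>2 t" for t
    unfolding p_def \<gamma>_def using 1(4) 2(2,4) by (intro trig_disjoint_add) auto
  have "N0 < \<bar>b\<bar> \<and> \<bar>b\<bar> \<le> W2" if "\<gamma> b \<noteq> 0" for b
  proof -
    have "\<gamma>1 b \<noteq> 0 \<or> \<gamma>2 b \<noteq> 0" using that by (auto simp: \<gamma>_def)
    then show ?thesis using 1(2) 1(4)[of b] 2(2) 2(4)[of b] by auto
  qed
  moreover have "\<bar>p b\<bar> \<le> 1/2" for b using 1(3)[of b] 2(3)[of b] by (simp add: p_def)
  moreover have "E1 \<union> E2 \<in> lmeasurable" using 1 2 by (intro fmeasurable.Un)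
  moreover have "measure lebesgue (E1 \<union> E2) \<le> \<epsilon>"
    using measure_Un_le[of E1 lebesgue E2] 1 2 by (simp add: fmeasurableD)
  moreover have "norm (trig W2 p \<gamma> t - (g t + h t)) \<le> \<eta>" if "\<bar>t\<bar> \<le> A" "t \<notin> E1 \<union> E2" for t
  proof -
    have "trig W2 p \<gamma> t - (g t + h t) = (trig W1 p1 \<gamma>1 t - g t) + (trig W2 p2 \<gamma>2 t - h t)" by (simp add: tr)
    then have "norm (trig W2 p \<gamma> t - (g t + h t)) \<le> norm (trig W1 p1 \<gamma>1 t - g t) + norm (trig W2 p2 \<gamma>2 t - h t)"
      by (simp only: norm_triangle_ineq)
    moreover have "norm (trig W1 p1 \<gamma>1 t - g t) \<le> \<eta> / 2" "norm (trig W2 p2 \<gamma>2 t - h t) \<le> \<eta> / 2"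
      using that by (blast intro: 1(7) 2(7))+
    ultimately show ?thesis by linarith
  qed
  ultimately show "\<exists>W p \<gamma> E. 0 \<le> W \<and> N0 \<le> W \<and> (\<forall>b. \<bar>p b\<bar> \<le> 1/2) \<and> (\<forall>b. \<gamma> b \<noteq> 0 \<longrightarrow> N0 < \<bar>b\<bar> \<and> \<bar>b\<bar> \<le> W) \<and>
        E \<in> lmeasurable \<and> measure lebesgue E \<le> \<epsilon> \<and>
        (\<forall>t. \<bar>t\<bar> \<le> A \<longrightarrow> t \<notin> E \<longrightarrow> norm (trig W p \<gamma> t - (g t + h t)) \<le> \<eta>)"
    using 1(2) 2(1,2)
    by (intro exI[of _ W2] exI[of _ p] exI[of _ \<gamma>] exI[of _ "E1 \<union> E2"] conjI) auto
qed

section \<open>Exponential polynomials and their density\<close>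

inductive exp_poly :: "(real \<Rightarrow> complex) \<Rightarrow> bool" where
  exp: "exp_poly (\<lambda>t. z * cis (\<theta> * t))"
| add: "exp_poly f \<Longrightarrow> exp_poly g \<Longrightarrow> exp_poly (\<lambda>t. f t + g t)"

lemma exp_poly_bin_approximable: "exp_poly f \<Longrightarrow> bin_approximable f"
  by (induction rule: exp_poly.induct) (auto intro: bin_approximable_exp bin_approximable_add)

lemma exp_poly_const: "exp_poly (\<lambda>t. z)"
  using exp_poly.exp[of z 0] by simp

lemma exp_poly_mult:
  assumes "exp_poly f" "exp_poly g" shows "exp_poly (\<lambda>t. f t * g t)"
  using assms
proof (induction arbitrary: g rule: exp_poly.induct)
  case (exp z \<theta>)
  from exp show ?case
  proof (induction rule: exp_poly.induct)
    case (exp w \<phi>)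
    have "(\<lambda>t. z * cis (\<theta> * t) * (w * cis (\<phi> * t))) = (\<lambda>t. (z * w) * cis ((\<theta> + \<phi>) * t))"
      by (simp add: fun_eq_iff distrib_right cis_mult[symmetric])
    then show ?case by (simp only: exp_poly.exp)
  next
    case (add f g)
    then show ?case by (simp only: distrib_left exp_poly.add)
  qed
next
  case (add f1 f2)
  then show ?case by (simp only: distrib_right exp_poly.add)
qed

lemma exp_poly_continuous: "exp_poly f \<Longrightarrow> continuous_on UNIV f"
  by (induction rule: exp_poly.induct) (auto intro!: continuous_intros)

text \<open>Stone-Weierstrass on [-A, A], applied to the real functions that are exponential
  polynomials. As arbitrary real frequencies are allowed, one sine slow enough to be injective on
  the interval separates the points.\<close>

lemma exp_poly_dense_real:
  fixes f :: "real \<Rightarrow> real"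
  assumes f: "continuous_on UNIV f" and A: "A \<ge> 0" and e: "e > 0"
  shows "\<exists>g. exp_poly (\<lambda>t. of_real (g t)) \<and> (\<forall>t. \<bar>t\<bar> \<le> A \<longrightarrow> \<bar>f t - g t\<bar> < e)"
proof -
  have "\<exists>g. exp_poly (\<lambda>t. of_real (g t)) \<and> (\<forall>t\<in>{-A..A}. \<bar>f t - g t\<bar> < e)"
  proof (rule Stone_Weierstrass_HOL[where P = "\<lambda>g. exp_poly (\<lambda>t. of_real (g t))"])
    show "continuous_on {-A..A} g" if "exp_poly (\<lambda>t. of_real (g t))" for g
    proof -
      have "continuous_on UNIV (\<lambda>t. Re (of_real (g t)))"
        by (intro continuous_intros exp_poly_continuous[OF that])
      then show ?thesis by (auto intro: continuous_on_subset)
    qed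
    show "\<exists>g. exp_poly (\<lambda>t. of_real (g t)) \<and> g x \<noteq> g y" if xy: "x \<in> {-A..A} \<and> y \<in> {-A..A} \<and> x \<noteq> y" for x y
    proof (intro exI[of _ "\<lambda>t. sin (1 / (A + 1) * t)"] conjI)
      have "(\<lambda>t. complex_of_real (sin (1 / (A + 1) * t))) =
         (\<lambda>t. (-\<i> / 2) * cis (1 / (A + 1) * t) + (\<i> / 2) * cis (- (1 / (A + 1)) * t))"
        by (rule ext) (simp add: complex_eq_iff)
      then show "exp_poly (\<lambda>t. complex_of_real (sin (1 / (A + 1) * t)))"
        by (simp only:) (intro exp_poly.intros)
      show "sin (1 / (A + 1) * x) \<noteq> sin (1 / (A + 1) * y)"
      proof
        assume eq: "sin (1 / (A + 1) * x) = sin (1 / (A + 1) * y)"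
        have "\<bar>1 / (A + 1) * t\<bar> \<le> pi / 2" if "t \<in> {-A..A}" for t
        proof -
          have "\<bar>1 / (A + 1) * t\<bar> = \<bar>t\<bar> / (A + 1)" using A by (simp add: abs_mult)
          also have "\<dots> \<le> 1" using that A by auto
          finally show ?thesis using pi_gt3 by linarith
        qed
        then have "\<bar>1 / (A + 1) * x\<bar> \<le> pi / 2" "\<bar>1 / (A + 1) * y\<bar> \<le> pi / 2" using xy by blast+
        then have "1 / (A + 1) * x = 1 / (A + 1) * y"
          by (intro sin_inj_pi[OF _ _ _ _ eq]) linarith+
        then show False using xy A by simp
      qed
    qed
  qed (use f e in \<open>auto intro: continuous_on_subset exp_poly_const exp_poly.add exp_poly_mult\<close>)
  then show ?thesis by (auto simp: abs_le_iff)
qed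

lemma exp_poly_dense:
  fixes f :: "real \<Rightarrow> complex"
  assumes f: "continuous_on UNIV f" and A: "A \<ge> 0" and e: "e > 0"
  shows "\<exists>g. exp_poly g \<and> (\<forall>t. \<bar>t\<bar> \<le> A \<longrightarrow> norm (f t - g t) < e)"
proof -
  have e2: "e / 2 > 0" using e by simp
  obtain u where u: "exp_poly (\<lambda>t. of_real (u t))" "\<And>t. \<bar>t\<bar> \<le> A \<Longrightarrow> \<bar>Re (f t) - u t\<bar> < e / 2"
    using exp_poly_dense_real[of "\<lambda>t. Re (f t)", OF _ A e2] f by (auto intro: continuous_intros)
  obtain v where v: "exp_poly (\<lambda>t. of_real (v t))" "\<And>t. \<bar>t\<bar> \<le> A \<Longrightarrow> \<bar>Im (f t) - v t\<bar> < e / 2"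
    using exp_poly_dense_real[of "\<lambda>t. Im (f t)", OF _ A e2] f by (auto intro: continuous_intros)
  have "exp_poly (\<lambda>t. of_real (u t) + \<i> * of_real (v t))"
    by (intro exp_poly.add u(1) exp_poly_mult exp_poly_const v(1))
  moreover have "norm (f t - (of_real (u t) + \<i> * of_real (v t))) < e" if "\<bar>t\<bar> \<le> A" for t
    using cmod_le[of "f t - (of_real (u t) + \<i> * of_real (v t))"] u(2)[OF that] v(2)[OF that] by simp
  ultimately show ?thesis by blast
qed

text \<open>A measurable function is an almost everywhere limit of continuous ones. On a bounded
  interval this implies convergence in measure, by dominated convergence for the indicators of the
  sets where the error exceeds \<eta>.\<close>

lemma lebesgue_measurable_approx_continuous:
  fixes f :: "real \<Rightarrow> complex"
  assumes f: "f \<in> borel_measurable lebesgue" and \<epsilon>: "\<epsilon> > 0" and \<eta>: "\<eta> > 0"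
  shows "\<exists>h E. continuous_on UNIV h \<and> E \<in> lmeasurable \<and> measure lebesgue E \<le> \<epsilon> \<and>
     (\<forall>t. \<bar>t\<bar> \<le> A \<longrightarrow> t \<notin> E \<longrightarrow> norm (h t - f t) \<le> \<eta>)"
proof -
  have "f measurable_on UNIV" using f by (simp add: measurable_on_iff_borel_measurable)
  then obtain N g where N: "negligible N" and g: "\<And>n. continuous_on UNIV (g n)"
    and lim: "\<And>x. x \<notin> N \<Longrightarrow> (\<lambda>n. g n x) \<longlonglongrightarrow> f x"
    unfolding measurable_on_def by auto
  define E where "E = (\<lambda>n. {t \<in> {-A..A}. norm (g n t - f t) > \<eta>})"
  have gm: "g n \<in> borel_measurable lebesgue" for n
    by (rule measurable_completion) (simp add: borel_measurable_continuous_onI[OF g])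
  have Es: "E n \<in> sets lebesgue" for n
  proof -
    have "{t \<in> space lebesgue. norm (g n t - f t) > \<eta>} \<in> sets lebesgue"
      using gm[of n] f by measurable
    then have "{-A..A} \<inter> {t \<in> space lebesgue. norm (g n t - f t) > \<eta>} \<in> sets lebesgue" by (intro sets.Int) auto
    moreover have "E n = {-A..A} \<inter> {t \<in> space lebesgue. norm (g n t - f t) > \<eta>}" by (auto simp: E_def)
    ultimately show ?thesis by simp
  qed
  have "{-A..A} \<in> lmeasurable" using lmeasurable_cbox[of "-A" A] by simp
  then have El: "E n \<in> lmeasurable" for n
    by (rule fmeasurableI2) (use Es in \<open>auto simp: E_def\<close>)
  have "(\<lambda>n. integral\<^sup>L lebesgue (indicator (E n) :: real \<Rightarrow> real)) \<longlonglongrightarrow> integral\<^sup>L lebesgue (\<lambda>_::real. 0 :: real)"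
  proof (rule integral_dominated_convergence[where w = "indicator {-A..A}"])
    show "integrable lebesgue (indicator {-A..A} :: real \<Rightarrow> real)"
      using \<open>{-A..A} \<in> lmeasurable\<close> by (auto simp: fmeasurable_def)
    show "AE x in lebesgue. (\<lambda>i. indicator (E i) x :: real) \<longlonglongrightarrow> 0"
    proof (rule AE_I'[of N])
      show "N \<in> null_sets lebesgue" using N by (simp add: negligible_iff_null_sets)
      show "{x \<in> space lebesgue. \<not> (\<lambda>i. indicator (E i) x :: real) \<longlonglongrightarrow> 0} \<subseteq> N"
      proof (rule subsetI, rule ccontr)
        fix x assume x: "x \<in> {x \<in> space lebesgue. \<not> (\<lambda>i. indicator (E i) x :: real) \<longlonglongrightarrow> 0}" and "x \<notin> N"
        have "eventually (\<lambda>n. dist (g n x) (f x) < \<eta>) sequentially"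
          using lim[OF \<open>x \<notin> N\<close>] \<eta> by (rule tendstoD)
        then have "eventually (\<lambda>n. indicator (E n) x = (0 :: real)) sequentially"
          by eventually_elim (auto simp: E_def dist_norm indicator_def)
        then have "(\<lambda>i. indicator (E i) x :: real) \<longlonglongrightarrow> 0" by (rule tendsto_eventually)
        with x show False by simp
      qed
    qed
  qed (use Es in \<open>auto simp: E_def indicator_def\<close>)
  then have "(\<lambda>n. measure lebesgue (E n)) \<longlonglongrightarrow> 0" using Es by simp
  then have "eventually (\<lambda>n. measure lebesgue (E n) < \<epsilon>) sequentially"
    using \<epsilon> by (intro order_tendstoD)
  then obtain n where n: "measure lebesgue (E n) < \<epsilon>" by (auto simp: eventually_sequentially)
  show ?thesis
    using n El g by (intro exI[of _ "g n"] exI[of _ "E n"]) (auto simp: E_def)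
qed

lemma measurable_bin_approximation:
  fixes f :: "real \<Rightarrow> complex"
  assumes f: "f \<in> borel_measurable lebesgue" and A: "A \<ge> 0" and \<epsilon>: "\<epsilon> > 0" and \<eta>: "\<eta> > 0"
  shows "\<exists>W p \<gamma> E. 0 \<le> W \<and> (\<forall>b. \<bar>p b\<bar> \<le> 1/2) \<and> E \<in> lmeasurable \<and> measure lebesgue E \<le> \<epsilon> \<and>
        (\<forall>t. \<bar>t\<bar> \<le> A \<longrightarrow> t \<notin> E \<longrightarrow> norm (trig W p \<gamma> t - f t) \<le> \<eta>)"
proof -
  have e: "\<epsilon> / 2 > 0" "\<eta> / 3 > 0" using \<epsilon> \<eta> by auto
  obtain h E1 where h: "continuous_on UNIV h" and E1: "E1 \<in> lmeasurable" "measure lebesgue E1 \<le> \<epsilon> / 2"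
    and hf: "\<And>t. \<bar>t\<bar> \<le> A \<Longrightarrow> t \<notin> E1 \<Longrightarrow> norm (h t - f t) \<le> \<eta> / 3"
    using lebesgue_measurable_approx_continuous[OF f e, of A] by (elim exE conjE) blast
  obtain g where g: "exp_poly g" and gh: "\<And>t. \<bar>t\<bar> \<le> A \<Longrightarrow> norm (h t - g t) < \<eta> / 3"
    using exp_poly_dense[OF h A e(2)] by blast
  obtain W p \<gamma> E2 where W: "0 \<le> W" "\<And>b. \<bar>p b\<bar> \<le> 1/2" and E2: "E2 \<in> lmeasurable" "measure lebesgue E2 \<le> \<epsilon> / 2"
    and tg: "\<And>t. \<bar>t\<bar> \<le> A \<Longrightarrow> t \<notin> E2 \<Longrightarrow> norm (trig W p \<gamma> t - g t) \<le> \<eta> / 3"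
    using exp_poly_bin_approximable[OF g, unfolded bin_approximable_def, rule_format, OF A e, of 0] by (elim exE conjE) blast
  have "norm (trig W p \<gamma> t - f t) \<le> \<eta>" if t: "\<bar>t\<bar> \<le> A" "t \<notin> E1 \<union> E2" for t
  proof -
    have "trig W p \<gamma> t - f t = (trig W p \<gamma> t - g t) + ((h t - f t) - (h t - g t))" by simp
    then have "norm (trig W p \<gamma> t - f t) = norm ((trig W p \<gamma> t - g t) + ((h t - f t) - (h t - g t)))" by simp
    then have "norm (trig W p \<gamma> t - f t) \<le> norm (trig W p \<gamma> t - g t) + (norm (h t - f t) + norm (h t - g t))"
      using norm_triangle_ineq[of "trig W p \<gamma> t - g t" "(h t - f t) - (h t - g t)"]
        norm_triangle_ineq4[of "h t - f t" "h t - g t"] by linarith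
    moreover have "norm (trig W p \<gamma> t - g t) \<le> \<eta> / 3" "norm (h t - f t) \<le> \<eta> / 3" "norm (h t - g t) < \<eta> / 3"
      using t by (blast intro: tg hf gh)+
    ultimately show ?thesis by linarith
  qed
  moreover have "measure lebesgue (E1 \<union> E2) \<le> \<epsilon>"
    using measure_Un_le[of E1 lebesgue E2] E1 E2 by (simp add: fmeasurableD)
  ultimately show ?thesis using W E1 E2
    by (intro exI[of _ W] exI[of _ p] exI[of _ \<gamma>] exI[of _ "E1 \<union> E2"]) auto
qed

section \<open>Corrections with pointwise controlled oscillation\<close>

text \<open>Together with strict monotonicity this is all that the deterministic part uses of a
  sample of the spectrum.\<close>

definition rich :: "(int \<Rightarrow> real) \<Rightarrow> bool" where
  "rich lam \<longleftrightarrow> near_integers lam \<and>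
     (\<forall>W p. (\<forall>b. \<bar>p b\<bar> \<le> 1/2) \<longrightarrow> pattern_recurs lam W p)"

text \<open>The essential point is the order of the quantifiers: C is fixed before g, and the partial sums are
  controlled at t by the value of g at t alone.\<close>

definition oscillation_bound :: "(int \<Rightarrow> real) \<Rightarrow> real \<Rightarrow> real \<Rightarrow> real \<Rightarrow> bool" where
  "oscillation_bound lam A \<epsilon> C \<longleftrightarrow> C \<ge> 0 \<and> (\<forall>g \<eta> N0. g \<in> borel_measurable lebesgue \<longrightarrow> \<eta> > 0 \<longrightarrow>
    (\<exists>f N1 E. N0 \<le> N1 \<and> (\<forall>k. f k \<noteq> 0 \<longrightarrow> N0 < \<bar>k\<bar> \<and> \<bar>k\<bar> \<le> N1) \<and>
       E \<in> lmeasurable \<and> measure lebesgue E \<le> \<epsilon> \<and>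
       (\<forall>t. \<bar>t\<bar> \<le> A \<longrightarrow> t \<notin> E \<longrightarrow> norm (psum lam f (of_int N1 + 1) t - g t) \<le> \<eta> \<and>
          (\<forall>x. norm (psum lam f x t) \<le> C * norm (g t) + \<eta>))))"

text \<open>A single block leaves the term 2 s B, where B depends on the approximant and not on
  |g(t)|. So R blocks with s = 1/R are added: cut blocks then cost 2B / R, which is small. Each
  exceptional set must be R times smaller, so c is proportional to \<epsilon> / R, and in s (8 / c)
  the factor R cancels. This leaves the constant \<open>D\<close>; completed blocks contribute at
  most |G(t)|, which is the 1 in \<open>C\<close>.\<close>

lemma rich_oscillation_bound:
  assumes rich: "rich lam" and A: "A \<ge> 0" and \<epsilon>: "\<epsilon> > 0"
  shows "\<exists>C. oscillation_bound lam A \<epsilon> C"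
proof -
  have lam: "near_integers lam" using rich by (simp add: rich_def)
  define K where "K = 2 * A + 12"
  have K: "K > 0" using A by (simp add: K_def)
  define D where "D = 16 * K / \<epsilon>"
  have D: "D \<ge> 0" using K \<epsilon> by (simp add: D_def)
  define C where "C = 1 + D"
  have "\<exists>f N1 E. N0 \<le> N1 \<and> (\<forall>k. f k \<noteq> 0 \<longrightarrow> N0 < \<bar>k\<bar> \<and> \<bar>k\<bar> \<le> N1) \<and>
       E \<in> lmeasurable \<and> measure lebesgue E \<le> \<epsilon> \<and>
       (\<forall>t. \<bar>t\<bar> \<le> A \<longrightarrow> t \<notin> E \<longrightarrow> norm (psum lam f (of_int N1 + 1) t - g t) \<le> \<eta> \<and>
          (\<forall>x. norm (psum lam f x t) \<le> C * norm (g t) + \<eta>))"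
    if g: "g \<in> borel_measurable lebesgue" and \<eta>: "\<eta> > 0" for g \<eta> N0
  proof -
    \<comment> \<open>Three errors of \<open>\<eta>'\<close> arise from the blocks, and C times
      \<open>\<eta>'\<close> from replacing the approximant by g in the bound.\<close>
    define \<eta>' where "\<eta>' = \<eta> / (C + 3)"
    have C0: "C \<ge> 1" using D by (simp add: C_def)
    have \<eta>': "\<eta>' > 0" using \<eta> C0 by (simp add: \<eta>'_def)
    have \<eta>C: "(C + 3) * \<eta>' = \<eta>" using C0 by (simp add: \<eta>'_def)
    have \<epsilon>2: "\<epsilon> / 2 > 0" using \<epsilon> by simp
    obtain W p \<gamma> E0 where W: "0 \<le> W" and p: "\<forall>b. \<bar>p b\<bar> \<le> 1/2" and E0: "E0 \<in> lmeasurable" "measure lebesgue E0 \<le> \<epsilon> / 2"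
      and Gg: "\<And>t. \<bar>t\<bar> \<le> A \<Longrightarrow> t \<notin> E0 \<Longrightarrow> norm (trig W p \<gamma> t - g t) \<le> \<eta>'"
      using measurable_bin_approximation[OF g A \<epsilon>2 \<eta>'] by (elim exE conjE) blast
    define B where "B = (\<Sum>b\<in>{-W..W}. norm (\<gamma> b))"
    have B: "B \<ge> 0" by (simp add: B_def sum_nonneg)
    obtain R0 :: nat where R0: "2 * B / \<eta>' < real R0" using reals_Archimedean2 by blast
    define R where "R = Suc R0"
    have R: "real R \<ge> 1" "2 * B / \<eta>' \<le> real R" using R0 by (auto simp: R_def)
    have BR: "2 * B / real R \<le> \<eta>'" using R \<eta>' by (simp add: field_simps)
    have \<eta>R: "\<eta>' / real R \<le> \<eta>'" using R \<eta>' by (simp add: field_simps)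
    have \<eta>R0: "\<eta>' / real R > 0" using R \<eta>' by simp
    \<comment> \<open>Each of the R exceptional sets gets measure at most \<epsilon> / (2R). The
      other half of \<epsilon> was spent on \<open>E0\<close>.\<close>
    define c where "c = \<epsilon> / (2 * real R * K)"
    have c: "c > 0" using \<epsilon> R K by (simp add: c_def)
    have Kc: "K * c = \<epsilon> / (2 * real R)" using K by (simp add: c_def)
    have match: "pattern_recurs lam W p" using rich p by (simp add: rich_def)
    let ?G = "trig W p \<gamma>"
    \<comment> \<open>Induction on the number r of blocks placed: the full sum is close to (r/R) G,
      and the bound on partial sums does not grow with r.\<close>
    have blocks: "\<exists>f N1 E. N0 \<le> N1 \<and> (\<forall>k. f k \<noteq> 0 \<longrightarrow> N0 < \<bar>k\<bar> \<and> \<bar>k\<bar> \<le> N1) \<and>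
       E \<in> lmeasurable \<and> measure lebesgue E \<le> real r * (\<epsilon> / (2 * real R)) \<and>
       (\<forall>t. \<bar>t\<bar> \<le> A \<longrightarrow> t \<notin> E \<longrightarrow>
          norm (psum lam f (of_int N1 + 1) t - of_real (real r / real R) * ?G t) \<le> real r * (\<eta>' / real R) \<and>
          (\<forall>x. norm (psum lam f x t) \<le> (1 + D) * norm (?G t) + 3 * \<eta>'))" if "r \<le> R" for r
      using that
    proof (induction r)
      case 0
      have "0 \<le> (1 + D) * norm (?G t) + 3 * \<eta>'" for t using D \<eta>' by simp
      then show ?case
        by (intro exI[of _ "\<lambda>_. 0"] exI[of _ N0] exI[of _ "{}"]) (simp add: psum_def)
    next
      case (Suc r)
      then obtain f1 N1 E1 where N1: "N0 \<le> N1" and s1: "\<And>k. f1 k \<noteq> 0 \<Longrightarrow> N0 < \<bar>k\<bar> \<and> \<bar>k\<bar> \<le> N1"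
        and E1: "E1 \<in> lmeasurable" "measure lebesgue E1 \<le> real r * (\<epsilon> / (2 * real R))"
        and a1: "\<And>t. \<bar>t\<bar> \<le> A \<Longrightarrow> t \<notin> E1 \<Longrightarrow>
           norm (psum lam f1 (of_int N1 + 1) t - of_real (real r / real R) * ?G t) \<le> real r * (\<eta>' / real R)"
        and b1: "\<And>t x. \<bar>t\<bar> \<le> A \<Longrightarrow> t \<notin> E1 \<Longrightarrow> norm (psum lam f1 x t) \<le> (1 + D) * norm (?G t) + 3 * \<eta>'"
        by (elim meta_impE exE conjE) (simp, blast)
      have s: "0 \<le> 1 / real R" by simp
      \<comment> \<open>Starting beyond N1 + 1 separates the stages exactly at the cutoff N1 + 1: up
        to it the new block contributes nothing, from it on the old blocks are complete.\<close>
      obtain f2 N2 N where N: "N \<ge> 1" and N2: "N1 + 1 \<le> N2" and s2: "\<And>k. f2 k \<noteq> 0 \<Longrightarrow> N1 + 1 < \<bar>k\<bar> \<and> \<bar>k\<bar> \<le> N2"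
        and a2: "\<And>t. \<bar>t\<bar> \<le> A \<Longrightarrow> c \<le> norm (1 - cis (of_int N * t)) \<Longrightarrow>
            norm (psum lam f2 (of_int N2 + 1) t - of_real (1 / real R) * ?G t) \<le> \<eta>' / real R"
        and b2: "\<And>t x. \<bar>t\<bar> \<le> A \<Longrightarrow> c \<le> norm (1 - cis (of_int N * t)) \<Longrightarrow>
            norm (psum lam f2 x t) \<le> 1 / real R * (8 / c) * norm (?G t) + 2 * (1 / real R) * B + \<eta>' / real R"
        using trig_mult_kernel_block[OF lam W match A c \<eta>R0 s, where ?N0.0 = "N1 + 1" and \<gamma> = \<gamma>, folded B_def]
        by (elim exE conjE) blast
      define E2 where "E2 = {t \<in> {-A..A}. norm (1 - cis (of_int N * t)) < c}"
      have E2: "E2 \<in> lmeasurable" "measure lebesgue E2 \<le> \<epsilon> / (2 * real R)"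
        using measure_cis_near_one[OF A c N, folded E2_def K_def] unfolding Kc by simp_all
      define f where "f = (\<lambda>k. f1 k + f2 k)"
      have ps: "psum lam f x t = psum lam f1 x t + psum lam f2 x t" for x t
        unfolding f_def by (rule psum_add)
      have full1: "psum lam f1 x t = psum lam f1 (of_int N1 + 1) t" if "x \<ge> of_int N1 + 1" for x t
        using s1 that by (intro psum_full[OF lam]) auto
      have D8: "1 / real R * (8 / c) = D" using \<epsilon> K R by (simp add: c_def D_def)
      have main: "norm (psum lam f (of_int N2 + 1) t - of_real (real (Suc r) / real R) * ?G t) \<le> real (Suc r) * (\<eta>' / real R) \<and>
          (\<forall>x. norm (psum lam f x t) \<le> (1 + D) * norm (?G t) + 3 * \<eta>')" if t: "\<bar>t\<bar> \<le> A" "t \<notin> E1 \<union> E2" for t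
      proof -
        have tc: "c \<le> norm (1 - cis (of_int N * t))" using t by (auto simp: E2_def)
        have t1: "t \<notin> E1" using t by simp
        have "psum lam f (of_int N2 + 1) t - of_real (real (Suc r) / real R) * ?G t
          = (psum lam f1 (of_int N1 + 1) t - of_real (real r / real R) * ?G t)
           + (psum lam f2 (of_int N2 + 1) t - of_real (1 / real R) * ?G t)"
          unfolding ps using N2 by (subst full1) (simp_all add: add_divide_distrib algebra_simps)
        then have "norm (psum lam f (of_int N2 + 1) t - of_real (real (Suc r) / real R) * ?G t)
           \<le> real r * (\<eta>' / real R) + \<eta>' / real R"
          using norm_triangle_le[OF add_mono[OF a1[OF t(1) t1] a2[OF t(1) tc]]] by simp
        also have "\<dots> = real (Suc r) * (\<eta>' / real R)" by (simp add: ring_distribs add_divide_distrib)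
        finally have 1: "norm (psum lam f (of_int N2 + 1) t - of_real (real (Suc r) / real R) * ?G t) \<le> real (Suc r) * (\<eta>' / real R)" .
        \<comment> \<open>Either the new block is absent and the induction hypothesis applies, or
          the old blocks sum to about (r/R) G and only the new one oscillates.\<close>
        have 2: "norm (psum lam f x t) \<le> (1 + D) * norm (?G t) + 3 * \<eta>'" for x
        proof (cases "x \<le> of_int (N1 + 1)")
          case True
          have "psum lam f2 x t = 0" by (rule psum_eq_0[OF lam _ True]) (use s2 in auto)
          then show ?thesis using b1[OF t(1) t1, of x] by (simp add: ps)
        next
          case False
          have rR: "real r / real R \<le> 1" "0 \<le> real r / real R" using Suc.prems R by auto
          have "norm (psum lam f1 x t) = norm (psum lam f1 (of_int N1 + 1) t)" using False by (subst full1) auto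
          also have "\<dots> \<le> real r * (\<eta>' / real R) + norm (of_real (real r / real R) * ?G t)"
            using a1[OF t(1) t1] norm_triangle_sub[of "psum lam f1 (of_int N1 + 1) t" "of_real (real r / real R) * ?G t"] by linarith
          also have "norm (of_real (real r / real R) * ?G t) = (real r / real R) * norm (?G t)"
            by (simp add: norm_mult norm_divide)
          also have "\<dots> \<le> 1 * norm (?G t)" using rR by (intro mult_right_mono) auto
          also have "real r * (\<eta>' / real R) = (real r / real R) * \<eta>'" by simp
          also have "\<dots> \<le> 1 * \<eta>'" using rR \<eta>' by (intro mult_right_mono) auto
          finally have x1: "norm (psum lam f1 x t) \<le> \<eta>' + norm (?G t)" by simp
          have x2: "norm (psum lam f2 x t) \<le> D * norm (?G t) + 2 * \<eta>'"
            using b2[OF t(1) tc, of x] BR \<eta>R unfolding D8 by simp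
          have "norm (psum lam f x t) \<le> norm (psum lam f1 x t) + norm (psum lam f2 x t)"
            unfolding ps by (rule norm_triangle_ineq)
          with x1 x2 show ?thesis by (simp add: distrib_right)
        qed
        from 1 2 show ?thesis by blast
      qed
      have "N0 < \<bar>k\<bar> \<and> \<bar>k\<bar> \<le> N2" if "f k \<noteq> 0" for k
      proof -
        have "f1 k \<noteq> 0 \<or> f2 k \<noteq> 0" using that by (auto simp: f_def)
        then show ?thesis using s1[of k] s2[of k] N1 N2 by auto
      qed
      moreover have "measure lebesgue (E1 \<union> E2) \<le> real (Suc r) * (\<epsilon> / (2 * real R))"
        using measure_Un_le[of E1 lebesgue E2] E1 E2 by (simp add: fmeasurableD distrib_right add_divide_distrib)
      ultimately show ?case using main N1 N2 E1(1) E2(1)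
        by (intro exI[of _ f] exI[of _ N2] exI[of _ "E1 \<union> E2"]) auto
    qed
    obtain f N1 E where N1: "N0 \<le> N1" and supp: "\<And>k. f k \<noteq> 0 \<Longrightarrow> N0 < \<bar>k\<bar> \<and> \<bar>k\<bar> \<le> N1"
        and E: "E \<in> lmeasurable" "measure lebesgue E \<le> real R * (\<epsilon> / (2 * real R))"
        and a: "\<And>t. \<bar>t\<bar> \<le> A \<Longrightarrow> t \<notin> E \<Longrightarrow>
           norm (psum lam f (of_int N1 + 1) t - of_real (real R / real R) * ?G t) \<le> real R * (\<eta>' / real R)"
        and b: "\<And>t x. \<bar>t\<bar> \<le> A \<Longrightarrow> t \<notin> E \<Longrightarrow> norm (psum lam f x t) \<le> (1 + D) * norm (?G t) + 3 * \<eta>'"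
      using blocks[OF order_refl] by (elim exE conjE) blast
    have R1: "real R / real R = 1" "real R * (\<eta>' / real R) = \<eta>'" "real R * (\<epsilon> / (2 * real R)) = \<epsilon> / 2" using R by auto
    have "norm (psum lam f (of_int N1 + 1) t - g t) \<le> \<eta> \<and> (\<forall>x. norm (psum lam f x t) \<le> C * norm (g t) + \<eta>)"
      if t: "\<bar>t\<bar> \<le> A" "t \<notin> E \<union> E0" for t
    proof -
      have G: "norm (?G t - g t) \<le> \<eta>'" using t by (intro Gg) auto
      have a': "norm (psum lam f (of_int N1 + 1) t - ?G t) \<le> \<eta>'" using a[of t] t unfolding R1 by simp
      have "norm (psum lam f (of_int N1 + 1) t - g t) \<le> norm (psum lam f (of_int N1 + 1) t - ?G t) + norm (?G t - g t)"
        using norm_triangle_ineq[of "psum lam f (of_int N1 + 1) t - ?G t" "?G t - g t"] by simp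
      also have "\<dots> \<le> 2 * \<eta>'" using a' G by simp
      also have "\<dots> \<le> (C + 3) * \<eta>'" using C0 \<eta>' by (intro mult_right_mono) auto
      finally have 1: "norm (psum lam f (of_int N1 + 1) t - g t) \<le> \<eta>" unfolding \<eta>C .
      have 2: "norm (psum lam f x t) \<le> C * norm (g t) + \<eta>" for x
      proof -
        have "norm (?G t) \<le> norm (g t) + \<eta>'" using G norm_triangle_sub[of "?G t" "g t"] by linarith
        then have "C * norm (?G t) \<le> C * (norm (g t) + \<eta>')" using C0 by (intro mult_left_mono) auto
        then have "norm (psum lam f x t) \<le> C * (norm (g t) + \<eta>') + 3 * \<eta>'"
          using b[of t x] t unfolding C_def by simp
        also have "\<dots> = C * norm (g t) + (C + 3) * \<eta>'" by (simp add: algebra_simps)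
        finally show ?thesis unfolding \<eta>C .
      qed
      from 1 2 show ?thesis by blast
    qed
    moreover have "measure lebesgue (E \<union> E0) \<le> \<epsilon>"
      using measure_Un_le[of E lebesgue E0] E E0 unfolding R1 by (simp add: fmeasurableD)
    ultimately show ?thesis using N1 supp E(1) E0(1)
      by (intro exI[of _ f] exI[of _ N1] exI[of _ "E \<union> E0"]) auto
  qed
  moreover have "C \<ge> 0" using D by (simp add: C_def)
  ultimately show ?thesis unfolding oscillation_bound_def by blast
qed

section \<open>The series\<close>

lemma borel_measurable_psum: "psum lam f x \<in> borel_measurable lebesgue"
proof -
  have "continuous_on UNIV (psum lam f x)"
    unfolding psum_def by (intro continuous_intros)
  then have "psum lam f x \<in> borel_measurable lborel" by (simp add: borel_measurable_continuous_onI)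
  then show ?thesis by (rule measurable_completion)
qed

text \<open>Stage j corrects the residual of f on [-j, j] off a set of measure 2^-j, using indices
  beyond all earlier ones. The constants \<open>C\<close> are given beforehand, so the tolerances
  \<eta> may be chosen in terms of them.\<close>

lemma correction_sequence:
  assumes rich: "rich lam" and f: "f \<in> borel_measurable lebesgue" and \<eta>: "\<And>j. \<eta> j > 0"
    and C: "\<And>j. oscillation_bound lam (real j) ((1/2) ^ j) (C j)"
  obtains c :: "nat \<Rightarrow> int \<Rightarrow> complex" and N :: "nat \<Rightarrow> int" and E
  where "\<And>j k. c j k \<noteq> 0 \<Longrightarrow> \<bar>k\<bar> \<le> N j" and "\<And>j. int j \<le> N j" and "\<And>j. N j + 1 \<le> N (Suc j)"
    and "\<And>j k. \<bar>k\<bar> \<le> N j + 1 \<Longrightarrow> c (Suc j) k = c j k"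
    and "\<And>j. E j \<in> lmeasurable" and "\<And>j. measure lebesgue (E j) \<le> (1/2) ^ j"
    and "\<And>j t. \<bar>t\<bar> \<le> real j \<Longrightarrow> t \<notin> E j \<Longrightarrow>
        norm (psum lam (c (Suc j)) (of_int (N (Suc j)) + 1) t - f t) \<le> \<eta> j"
    and "\<And>j t x. \<bar>t\<bar> \<le> real j \<Longrightarrow> t \<notin> E j \<Longrightarrow>
        norm (psum lam (c (Suc j)) x t - psum lam (c j) x t)
              \<le> C j * norm (f t - psum lam (c j) (of_int (N j) + 1) t) + \<eta> j"
proof -
  have lam: "near_integers lam" using rich by (simp add: rich_def)
  define P where "P = (\<lambda>(j::nat) (c :: int \<Rightarrow> complex, N :: int). (\<forall>k. c k \<noteq> 0 \<longrightarrow> \<bar>k\<bar> \<le> N) \<and> int j \<le> N)"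
  define Q' where "Q' = (\<lambda>j (c :: int \<Rightarrow> complex, N :: int) (c', N') E. N + 1 \<le> N' \<and> (\<forall>k. \<bar>k\<bar> \<le> N + 1 \<longrightarrow> c' k = c k) \<and>
     E \<in> lmeasurable \<and> measure lebesgue E \<le> (1/2) ^ j \<and>
     (\<forall>t. \<bar>t\<bar> \<le> real j \<longrightarrow> t \<notin> E \<longrightarrow>
        norm (psum lam c' (of_int N' + 1) t - f t) \<le> \<eta> j \<and>
        (\<forall>x. norm (psum lam c' x t - psum lam c x t)
              \<le> C j * norm (f t - psum lam c (of_int N + 1) t) + \<eta> j)))"
  have "\<exists>s. \<forall>j. P j (s j) \<and> (\<exists>E. Q' j (s j) (s (Suc j)) E)"
  proof (rule dependent_nat_choice)
    show "\<exists>x. P 0 x" by (rule exI[of _ "(\<lambda>_. 0, 0)"]) (simp add: P_def)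
  next
    fix x :: "(int \<Rightarrow> complex) \<times> int" and j
    assume Px: "P j x"
    obtain c N where x: "x = (c, N)" by (cases x)
    have c: "\<And>k. c k \<noteq> 0 \<Longrightarrow> \<bar>k\<bar> \<le> N" and jN: "int j \<le> N" using Px by (auto simp: P_def x)
    define g where "g = (\<lambda>t. f t - psum lam c (of_int N + 1) t)"
    have g: "g \<in> borel_measurable lebesgue"
      unfolding g_def using f borel_measurable_psum by (rule borel_measurable_diff)
    \<comment> \<open>The correction leaves the indices up to N + 1 alone, not just up to N, since
      index N + 1 may have a frequency below the cutoff N + 1.\<close>
    obtain h N1 E where N1: "N + 1 \<le> N1" and h: "\<And>k. h k \<noteq> 0 \<Longrightarrow> N + 1 < \<bar>k\<bar> \<and> \<bar>k\<bar> \<le> N1"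
      and E: "E \<in> lmeasurable" "measure lebesgue E \<le> (1/2) ^ j"
      and hg: "\<And>t. \<bar>t\<bar> \<le> real j \<Longrightarrow> t \<notin> E \<Longrightarrow> norm (psum lam h (of_int N1 + 1) t - g t) \<le> \<eta> j"
      and hx: "\<And>t x. \<bar>t\<bar> \<le> real j \<Longrightarrow> t \<notin> E \<Longrightarrow> norm (psum lam h x t) \<le> C j * norm (g t) + \<eta> j"
      using C[of j, unfolded oscillation_bound_def, THEN conjunct2, rule_format, OF g \<eta>, of "N + 1" j] by (elim exE conjE) blast
    define c' where "c' = (\<lambda>k. c k + h k)"
    have ps: "psum lam c' x t = psum lam c x t + psum lam h x t" for x t
      unfolding c'_def by (rule psum_add)
    have full: "psum lam c (of_int N1 + 1) t = psum lam c (of_int N + 1) t" for t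
      using c N1 by (intro psum_full[OF lam]) auto
    have "\<bar>k\<bar> \<le> N1" if "c' k \<noteq> 0" for k
    proof -
      have "c k \<noteq> 0 \<or> h k \<noteq> 0" using that by (auto simp: c'_def)
      then show ?thesis using c[of k] h[of k] N1 by auto
    qed
    then have "P (Suc j) (c', N1)" using jN N1 by (simp add: P_def)
    moreover have "Q' j (c, N) (c', N1) E"
      unfolding Q'_def prod.case
    proof (intro conjI allI impI)
      fix k assume "\<bar>k\<bar> \<le> N + 1"
      then have "h k = 0" using h[of k] by force
      then show "c' k = c k" by (simp add: c'_def)
    next
      fix t assume t: "\<bar>t\<bar> \<le> real j" "t \<notin> E"
      have "psum lam c' (of_int N1 + 1) t - f t = psum lam h (of_int N1 + 1) t - g t"
        unfolding ps full g_def by simp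
      then show "norm (psum lam c' (of_int N1 + 1) t - f t) \<le> \<eta> j" using hg[OF t] by simp
      fix x
      show "norm (psum lam c' x t - psum lam c x t) \<le> C j * norm (f t - psum lam c (of_int N + 1) t) + \<eta> j"
        using hx[OF t, of x] by (simp add: ps g_def)
    qed (use N1 E in auto)
    ultimately show "\<exists>y. P (Suc j) y \<and> (\<exists>E. Q' j x y E)" unfolding x by blast
  qed
  then obtain s where s: "\<And>j. P j (s j)" and "\<And>j. \<exists>E. Q' j (s j) (s (Suc j)) E" by blast
  then obtain E where E: "\<And>j. Q' j (s j) (s (Suc j)) (E j)" by metis
  show thesis
  proof (rule that[of "\<lambda>j. fst (s j)" "\<lambda>j. snd (s j)" E])
    show "fst (s j) k \<noteq> 0 \<Longrightarrow> \<bar>k\<bar> \<le> snd (s j)" and "int j \<le> snd (s j)" for j k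
      using s[of j] by (auto simp: P_def case_prod_beta)
  qed (use E in \<open>simp_all add: Q'_def case_prod_beta\<close>)
qed

text \<open>For almost every t, Borel-Cantelli puts t outside all late exceptional sets. There the
  residual after stage i is at most \<eta> i, so the partial sums of the next correction have size
  at most C (i+1) \<eta> i + \<eta> (i+1), which tends to 0.\<close>

lemma rich_imp_Menshov_spectrum:
  assumes rich: "rich lam" and mono: "strict_mono lam"
  shows "Menshov_spectrum lam"
  unfolding Menshov_spectrum_def
proof (intro conjI mono allI impI)
  fix f :: "real \<Rightarrow> complex" assume f: "f \<in> borel_measurable lebesgue"
  have lam: "near_integers lam" using rich by (simp add: rich_def)
  have "\<forall>j::nat. \<exists>C. oscillation_bound lam (real j) ((1/2) ^ j) C"
    by (intro allI rich_oscillation_bound[OF rich]) auto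
  from choice[OF this] obtain C where C: "\<And>j. oscillation_bound lam (real j) ((1/2) ^ j) (C j)" by blast
  have C0: "C j \<ge> 0" for j using C by (simp add: oscillation_bound_def)
  \<comment> \<open>The tolerance of a stage absorbs the oscillation constant of the next
    one.\<close>
  define \<eta> where "\<eta> = (\<lambda>j. (1/2) ^ j / (1 + C (Suc j)))"
  have C1: "1 + C j > 0" for j using C0[of j] by linarith
  have \<eta>: "\<eta> j > 0" for j using C1[of "Suc j"] by (simp add: \<eta>_def)
  have \<eta>le: "\<eta> j \<le> (1/2) ^ j" for j
    unfolding \<eta>_def using C0[of "Suc j"] by (simp add: divide_le_eq mult_left_le)
  have C\<eta>: "C (Suc j) * \<eta> j \<le> (1/2) ^ j" for j
  proof -
    have "C (Suc j) * \<eta> j \<le> (1 + C (Suc j)) * \<eta> j" using \<eta>[of j] by (intro mult_right_mono) auto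
    also have "\<dots> = (1/2) ^ j" using C1[of "Suc j"] by (simp add: \<eta>_def)
    finally show ?thesis .
  qed
  obtain c N E where c: "\<And>j k. c j k \<noteq> 0 \<Longrightarrow> \<bar>k\<bar> \<le> N j" and jN: "\<And>j. int j \<le> N j" and NS: "\<And>j. N j + 1 \<le> N (Suc j)"
    and cS: "\<And>j k. \<bar>k\<bar> \<le> N j + 1 \<Longrightarrow> c (Suc j) k = c j k"
    and E: "\<And>j. E j \<in> lmeasurable" "\<And>j. measure lebesgue (E j) \<le> (1/2) ^ j"
    and app: "\<And>j t. \<bar>t\<bar> \<le> real j \<Longrightarrow> t \<notin> E j \<Longrightarrow>
        norm (psum lam (c (Suc j)) (of_int (N (Suc j)) + 1) t - f t) \<le> \<eta> j"
    and osc: "\<And>j t x. \<bar>t\<bar> \<le> real j \<Longrightarrow> t \<notin> E j \<Longrightarrow>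
        norm (psum lam (c (Suc j)) x t - psum lam (c j) x t)
              \<le> C j * norm (f t - psum lam (c j) (of_int (N j) + 1) t) + \<eta> j"
    by (rule correction_sequence[where \<eta> = \<eta>, OF rich f \<eta> C]) blast
  have Nmono: "N i \<le> N j" if "i \<le> j" for i j
    using that by (rule lift_Suc_mono_le[rotated]) (use NS in \<open>smt (verit)\<close>)
  have stab: "c j k = c i k" if "i \<le> j" "\<bar>k\<bar> \<le> N i + 1" for i j k
    using that
  proof (induction j rule: dec_induct)
    case (step n)
    then have "\<bar>k\<bar> \<le> N n + 1" using Nmono[of i n] by linarith
    then show ?case using step cS by simp
  qed simp
  \<comment> \<open>Coefficient k is final from stage |k| on, because |k| \<le> N (|k|).\<close>
  define d where "d = (\<lambda>k. c (nat \<bar>k\<bar>) k)"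
  have d: "d k = c j k" if "\<bar>k\<bar> \<le> N j + 1" for j k
  proof -
    have "\<bar>k\<bar> \<le> N (nat \<bar>k\<bar>) + 1" using jN[of "nat \<bar>k\<bar>"] by simp
    then show ?thesis unfolding d_def using that stab[of j "nat \<bar>k\<bar>" k] stab[of "nat \<bar>k\<bar>" j k]
      by (cases "j \<le> nat \<bar>k\<bar>") auto
  qed
  have "summable (\<lambda>j. measure lebesgue (E j))"
    by (rule summable_comparison_test'[of "\<lambda>j. (1/2::real) ^ j" 0]) (use E in \<open>auto simp: summable_geometric\<close>)
  then have "AE t in lebesgue. eventually (\<lambda>j. t \<in> space lebesgue - E j) sequentially"
    by (rule borel_cantelli_AE1[rotated 2]) (use E(1) in \<open>unfold fmeasurable_def, blast+\<close>)
  then have "AE t in lebesgue. ((\<lambda>x. psum lam d x t) \<longlongrightarrow> f t) at_top"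
  proof eventually_elim
    fix t assume "eventually (\<lambda>j. t \<in> space lebesgue - E j) sequentially"
    moreover have "eventually (\<lambda>j. \<bar>t\<bar> \<le> real j) sequentially"
      using filterlim_real_sequentially by (simp add: filterlim_at_top)
    ultimately have "eventually (\<lambda>j. t \<notin> E j \<and> \<bar>t\<bar> \<le> real j) sequentially"
      by eventually_elim auto
    then obtain j0 where j0: "\<And>j. j \<ge> j0 \<Longrightarrow> t \<notin> E j" "\<And>j. j \<ge> j0 \<Longrightarrow> \<bar>t\<bar> \<le> real j"
      by (auto simp: eventually_sequentially)
    have key: "norm (psum lam d x t - f t) \<le> 3 * (1/2) ^ j" if j: "j \<ge> j0" and x: "x > of_int (N (Suc j)) + 1" for j x
    proof -
      \<comment> \<open>The cutoff x falls into the correction that produces c n: the earlier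
        corrections are complete at x and the later ones have not begun. As x is large, n \<ge> j +
        2.\<close>
      define n where "n = (LEAST n. x \<le> of_int (N n) + 1)"
      obtain m :: nat where "x < real m" using reals_Archimedean2 by blast
      then have "x \<le> of_int (N m) + 1" using jN[of m] by linarith
      then have n: "x \<le> of_int (N n) + 1" unfolding n_def by (rule LeastI)
      have "\<not> n \<le> Suc j" using n x Nmono[of n "Suc j"] by linarith
      then obtain i where i: "n = Suc (Suc i)" "j \<le> i"
        by (metis Suc_leI Suc_le_D Suc_le_mono not_less_eq_eq)
      have "\<not> x \<le> of_int (N (Suc i)) + 1" using i unfolding n_def by (intro not_less_Least) simp
      then have xi: "x \<ge> of_int (N (Suc i)) + 1" by simp
      have "psum lam d x t = psum lam (c n) x t"
        unfolding psum_def
      proof (rule sum.cong)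
        fix k assume "k \<in> {k. \<bar>lam k\<bar> < x}"
        moreover have "\<bar>lam k - of_int k\<bar> \<le> 1/2" using lam by (simp add: near_integers_def)
        ultimately have "\<bar>real_of_int k\<bar> < of_int (N n) + 2" using n unfolding mem_Collect_eq by linarith
        then have "\<bar>k\<bar> \<le> N n + 1" by linarith
        then show "d k * cis (lam k * t) = c n k * cis (lam k * t)" by (simp add: d)
      qed simp
      moreover have "psum lam (c (Suc i)) x t = psum lam (c (Suc i)) (of_int (N (Suc i)) + 1) t"
        using c xi by (intro psum_full[OF lam]) auto
      ultimately have eq: "psum lam d x t - f t = (psum lam (c (Suc (Suc i))) x t - psum lam (c (Suc i)) x t)
          + (psum lam (c (Suc i)) (of_int (N (Suc i)) + 1) t - f t)" by (simp add: i)
      have a: "norm (psum lam (c (Suc i)) (of_int (N (Suc i)) + 1) t - f t) \<le> \<eta> i"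
        using j0[of i] i j by (intro app) auto
      then have "C (Suc i) * norm (f t - psum lam (c (Suc i)) (of_int (N (Suc i)) + 1) t) \<le> C (Suc i) * \<eta> i"
        using C0[of "Suc i"] by (intro mult_left_mono) (auto simp: norm_minus_commute)
      then have "C (Suc i) * norm (f t - psum lam (c (Suc i)) (of_int (N (Suc i)) + 1) t) \<le> (1/2) ^ i" using C\<eta>[of i] by linarith
      moreover have "\<eta> (Suc i) \<le> (1/2) ^ i" using \<eta>le[of "Suc i"] power_decreasing[of i "Suc i" "1/2::real"] by linarith
      moreover have "norm (psum lam (c (Suc (Suc i))) x t - psum lam (c (Suc i)) x t)
         \<le> C (Suc i) * norm (f t - psum lam (c (Suc i)) (of_int (N (Suc i)) + 1) t) + \<eta> (Suc i)"
        using j0[of "Suc i"] i j by (intro osc) auto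
      ultimately have "norm (psum lam (c (Suc (Suc i))) x t - psum lam (c (Suc i)) x t) \<le> 2 * (1/2) ^ i" by linarith
      then have "norm (psum lam d x t - f t) \<le> 3 * (1/2) ^ i"
        using norm_triangle_ineq[of "psum lam (c (Suc (Suc i))) x t - psum lam (c (Suc i)) x t"
           "psum lam (c (Suc i)) (of_int (N (Suc i)) + 1) t - f t", folded eq] a \<eta>le[of i] by linarith
      also have "(1/2::real) ^ i \<le> (1/2) ^ j" using i by (intro power_decreasing) auto
      finally show ?thesis by simp
    qed
    show "((\<lambda>x. psum lam d x t) \<longlongrightarrow> f t) at_top"
    proof (rule tendstoI)
      fix e :: real assume e: "e > 0"
      have "(\<lambda>j. 3 * (1/2::real) ^ j) \<longlonglongrightarrow> 3 * 0" by (intro tendsto_intros) auto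
      then have "eventually (\<lambda>j. 3 * (1/2::real) ^ j < e) sequentially" using e by (intro order_tendstoD) auto
      then have "eventually (\<lambda>j. 3 * (1/2::real) ^ j < e \<and> j \<ge> j0) sequentially"
        using eventually_ge_at_top[of j0] by eventually_elim auto
      then obtain j where j: "3 * (1/2::real) ^ j < e" "j \<ge> j0" by (auto simp: eventually_sequentially)
      show "eventually (\<lambda>x. dist (psum lam d x t) (f t) < e) at_top"
        using eventually_gt_at_top[of "of_int (N (Suc j)) + 1"]
      proof eventually_elim
        fix x :: real assume "of_int (N (Suc j)) + 1 < x"
        from key[OF j(2) this] j(1) show "dist (psum lam d x t) (f t) < e" by (simp add: dist_norm)
      qed
    qed
  qed
  then show "\<exists>c. AE t in lebesgue. ((\<lambda>x. \<Sum>k\<in>{k. \<bar>lam k\<bar> < x}. c k * exp (\<i> * complex_of_real (lam k * t))) \<longlongrightarrow> f t) at_top"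
    unfolding psum_def cis_conv_exp by blast
qed

section \<open>Recurrence of patterns\<close>

context prob_space
begin

text \<open>An interval of length min \<eta> (1/2) with endpoint q, laid from q towards 0, fits into
  [-1/2, 1/2]. The lower bound is therefore uniform in q.\<close>

lemma prob_uniform_near:
  fixes X :: "'a \<Rightarrow> real"
  assumes X[measurable]: "X \<in> borel_measurable M" and D: "distr M borel X = uniform_measure lborel {-1/2..1/2}"
    and q: "\<bar>q\<bar> \<le> 1/2" and \<eta>: "\<eta> > 0"
  shows "min \<eta> (1/2) \<le> prob (X -` {q - \<eta>..q + \<eta>} \<inter> space M)"
proof -
  define b where "b = min \<eta> (1/2)"
  have b: "0 < b" "b \<le> \<eta>" "b \<le> 1/2" using \<eta> by (auto simp: b_def)
  define l where "l = (if q \<le> 0 then q else q - b)"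
  have "{l..l + b} \<subseteq> {-1/2..1/2} \<inter> {q - \<eta>..q + \<eta>}"
    using q b by (auto simp: l_def abs_le_iff split: if_splits)
  moreover have "{-1/2..1/2} \<inter> {q - \<eta>..q + \<eta>} \<in> fmeasurable lborel"
    by (intro fmeasurable_Int_fmeasurable) (auto simp: fmeasurable_def)
  ultimately have "measure lborel {l..l + b} \<le> measure lborel ({-1/2..1/2} \<inter> {q - \<eta>..q + \<eta>})"
    by (intro measure_mono_fmeasurable) auto
  also have "\<dots> = measure (uniform_measure lborel {-1/2..1/2}) {q - \<eta>..q + \<eta>}"
    by (subst measure_uniform_measure) auto
  also have "\<dots> = prob (X -` {q - \<eta>..q + \<eta>} \<inter> space M)"
    unfolding D[symmetric] by (rule measure_distr) auto
  finally show ?thesis using b by (simp add: b_def)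
qed

text \<open>Along a lacunary sequence of candidates \<open>N i\<close> the index sets involved are
  disjoint, so the events \<open>F i\<close> are independent. Each has probability at least one
  fixed positive number, hence almost surely one of them occurs.\<close>

lemma independent_patterns_recur:
  fixes r :: "int \<Rightarrow> 'a \<Rightarrow> real" and q :: "int \<Rightarrow> real" and W M0 N0 :: int and \<eta> :: real
  assumes ind: "indep_vars (\<lambda>_. borel) r UNIV"
    and D: "\<And>n. distr M borel (r n) = uniform_measure lborel {-1/2..1/2}"
    and W: "W \<ge> 0" and M0: "M0 \<ge> 1" and q: "\<And>b. \<bar>q b\<bar> \<le> 1/2" and \<eta>: "\<eta> > 0"
  shows "AE \<omega> in M. \<exists>N>N0. \<forall>m b. 0 < \<bar>m\<bar> \<longrightarrow> \<bar>m\<bar> \<le> M0 \<longrightarrow> \<bar>b\<bar> \<le> W \<longrightarrow> \<bar>r (m * N + b) \<omega> - q b\<bar> \<le> \<eta>"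
proof -
  have r[measurable]: "r k \<in> borel_measurable M" for k using ind by (simp add: indep_vars_def)
  \<comment> \<open>The indices of candidate i have modulus between N i - W and M0 N i + W. Growth
    by the factor L makes these ranges disjoint.\<close>
  define L where "L = M0 + 2 * W + 2"
  have L: "L \<ge> 2" "L > 2 * W" "L \<ge> M0 + 2 * W + 1" using W M0 by (auto simp: L_def)
  define N where "N = (\<lambda>i::nat. L ^ (i + 1 + nat \<bar>N0\<bar>))"
  have NL: "N i \<ge> L" for i
    unfolding N_def using L power_increasing[of 1 "i + 1 + nat \<bar>N0\<bar>" L] by simp
  have NN0: "N i > N0" for i
  proof -
    have "int (i + 1 + nat \<bar>N0\<bar>) < 2 ^ (i + 1 + nat \<bar>N0\<bar>)" by (rule of_nat_less_two_power)
    also have "(2::int) ^ (i + 1 + nat \<bar>N0\<bar>) \<le> N i" unfolding N_def using L by (intro power_mono) auto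
    finally show ?thesis by linarith
  qed
  have Nstep: "N j \<ge> L * N i" if "i < j" for i j
  proof -
    have "L * N i = L ^ Suc (i + 1 + nat \<bar>N0\<bar>)" by (simp add: N_def)
    also have "\<dots> \<le> N j" unfolding N_def using L that by (intro power_increasing) auto
    finally show ?thesis .
  qed
  define I where "I = ({-M0..M0}-{0}) \<times> {-W..W}"
  define K where "K = (\<lambda>i. (\<lambda>(m, b). m * N i + b) ` I)"
  have finI: "finite I" by (simp add: I_def)
  have finK: "finite (K i)" for i by (simp add: K_def finI)
  have Ine: "I \<noteq> {}"
  proof -
    have "(1, 0) \<in> I" using M0 W by (simp add: I_def)
    then show ?thesis by blast
  qed
  then have Kne: "K i \<noteq> {}" for i by (simp add: K_def)
  have Kb: "N i - W \<le> \<bar>k\<bar> \<and> \<bar>k\<bar> \<le> M0 * N i + W" if k: "k \<in> K i" for i k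
  proof -
    obtain m b where mb: "(m, b) \<in> I" "k = m * N i + b" using k by (auto simp: K_def)
    then have m: "1 \<le> \<bar>m\<bar>" "\<bar>m\<bar> \<le> M0" and b: "\<bar>b\<bar> \<le> W" by (auto simp: I_def)
    have Ni: "0 \<le> N i" using NL[of i] L by linarith
    have "1 * N i \<le> \<bar>m\<bar> * N i" "\<bar>m\<bar> * N i \<le> M0 * N i" 
      using mult_right_mono[OF m(1) Ni] mult_right_mono[OF m(2) Ni] by simp_all
    moreover have "\<bar>m * N i\<bar> = \<bar>m\<bar> * N i" using Ni by (simp add: abs_mult)
    ultimately show ?thesis using b mb(2) by linarith
  qed
  have disj: "K i \<inter> K j = {}" if "i < j" for i j
  proof (rule ccontr)
    assume "K i \<inter> K j \<noteq> {}"
    then obtain k where "k \<in> K i" "k \<in> K j" by blast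
    then have "N j - W \<le> M0 * N i + W" using Kb by (meson order_trans)
    moreover have "(M0 + 2 * W + 1) * N i \<le> L * N i" using L NL[of i] by (intro mult_right_mono) auto
    then have *: "M0 * N i + (2 * W + 1) * N i \<le> N j" using Nstep[OF that] by (simp add: algebra_simps)
    have "(2 * W + 1) * 1 \<le> (2 * W + 1) * N i" using W NL[of i] L by (intro mult_left_mono) auto
    then have "M0 * N i + (2 * W + 1) \<le> N j" by (intro order_trans[OF add_left_mono *]) simp
    ultimately show False by linarith
  qed
  have "disjoint_family_on K UNIV"
    unfolding disjoint_family_on_def using disj by (metis Int_commute linorder_neqE_nat)
  then have ind2: "indep_vars (\<lambda>i. PiM (K i) (\<lambda>_. borel)) (\<lambda>i \<omega>. restrict (\<lambda>k. r k \<omega>) (K i)) UNIV"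
    by (intro indep_vars_restrict[OF ind]) auto
  \<comment> \<open>The target offset is expressed through the index alone: since 0 \<le> b + W
    \<le> 2W < N i, reduction modulo N i recovers b from mN i + b.\<close>
  define Q where "Q = (\<lambda>i k. q ((k + W) mod N i - W))"
  have Q: "Q i (m * N i + b) = q b" if "\<bar>b\<bar> \<le> W" for i m b
  proof -
    have "(m * N i + b + W) mod N i = (b + W) mod N i"
      by (metis add.assoc mod_mult_self3 add.commute)
    also have "\<dots> = b + W" using that L NL[of i] by (intro mod_pos_pos_trivial) auto
    finally show ?thesis by (simp add: Q_def)
  qed
  have Qb: "\<bar>Q i k\<bar> \<le> 1/2" for i k using q by (simp add: Q_def)
  define F where "F = (\<lambda>i. {\<omega> \<in> space M. \<forall>k\<in>K i. \<bar>r k \<omega> - Q i k\<bar> \<le> \<eta>})"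
  have F[measurable]: "F i \<in> events" for i
    unfolding F_def by (intro sets.sets_Collect_finite_All finK) measurable
  define \<beta> where "\<beta> = min \<eta> (1/2)"
  have \<beta>: "0 < \<beta>" "\<beta> \<le> 1/2" using \<eta> by (auto simp: \<beta>_def)
  have PF: "\<beta> ^ card I \<le> prob (F i)" for i
  proof -
    have "F i = (\<Inter>k\<in>K i. r k -` {Q i k - \<eta>..Q i k + \<eta>} \<inter> space M)"
      using Kne[of i] by (auto simp: F_def abs_le_iff algebra_simps)
    also have "prob \<dots> = (\<Prod>k\<in>K i. prob (r k -` {Q i k - \<eta>..Q i k + \<eta>} \<inter> space M))"
      by (rule indep_varsD[OF ind Kne finK]) auto
    also have "\<dots> \<ge> (\<Prod>k\<in>K i. \<beta>)"
      unfolding \<beta>_def using \<eta> by (intro prod_mono conjI prob_uniform_near[OF r D Qb \<eta>]) auto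
    finally have "\<beta> ^ card (K i) \<le> prob (F i)" by simp
    moreover have "card (K i) \<le> card I" unfolding K_def by (rule card_image_le[OF finI])
    then have "\<beta> ^ card I \<le> \<beta> ^ card (K i)" using \<beta> by (intro power_decreasing) auto
    ultimately show ?thesis by linarith
  qed
  define B where "B = (\<Inter>i. space M - F i)"
  have B: "B \<in> events" unfolding B_def by measurable
  have bound: "prob B \<le> (1 - \<beta> ^ card I) ^ Suc n" for n
  proof -
    \<comment> \<open>The failure of \<open>F i\<close> is rewritten as an event of the restricted
      family on \<open>K i\<close>, to which independence of the groups applies.\<close>
    define S where "S = (\<lambda>i. {x \<in> space (PiM (K i) (\<lambda>_. borel :: real measure)). \<not> (\<forall>k\<in>K i. \<bar>x k - Q i k\<bar> \<le> \<eta>)})"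
    have S: "S i \<in> sets (PiM (K i) (\<lambda>_. borel))" for i
      unfolding S_def by (intro sets.sets_Collect_neg sets.sets_Collect_finite_All finK) measurable
    have SF: "(\<lambda>\<omega>. restrict (\<lambda>k. r k \<omega>) (K i)) -` S i \<inter> space M = space M - F i" for i
      by (auto simp: S_def F_def space_PiM)
    have "prob B \<le> prob (\<Inter>i\<in>{..n}. space M - F i)"
      by (intro finite_measure_mono) (auto simp: B_def)
    also have "\<dots> = (\<Prod>i\<in>{..n}. prob (space M - F i))"
      using indep_varsD[OF ind2, of "{..n}" S] S unfolding SF by auto
    also have "\<dots> \<le> (\<Prod>i\<in>{..n}. 1 - \<beta> ^ card I)"
      using PF by (intro prod_mono) (auto simp: prob_compl)
    also have "\<dots> = (1 - \<beta> ^ card I) ^ Suc n" by simp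
    finally show ?thesis .
  qed
  have "(\<lambda>n. (1 - \<beta> ^ card I) ^ Suc n) \<longlonglongrightarrow> 0"
    using \<beta> by (intro LIMSEQ_Suc LIMSEQ_realpow_zero) (auto simp: power_le_one)
  then have "prob B \<le> 0"
    by (rule LIMSEQ_le_const) (use bound in auto)
  then have "B \<in> null_sets M"
    using B by (simp add: null_sets_def emeasure_eq_measure measure_le_0_iff)
  then have "AE \<omega> in M. \<omega> \<notin> B" by (rule AE_not_in)
  then show ?thesis
  proof (rule AE_mp, intro AE_I2 impI)
    fix \<omega> assume "\<omega> \<in> space M" "\<omega> \<notin> B"
    then obtain i where i: "\<omega> \<in> F i" by (auto simp: B_def)
    show "\<exists>N>N0. \<forall>m b. 0 < \<bar>m\<bar> \<longrightarrow> \<bar>m\<bar> \<le> M0 \<longrightarrow> \<bar>b\<bar> \<le> W \<longrightarrow> \<bar>r (m * N + b) \<omega> - q b\<bar> \<le> \<eta>"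
    proof (intro exI[of _ "N i"] conjI NN0 allI impI)
      fix m b :: int assume mb: "0 < \<bar>m\<bar>" "\<bar>m\<bar> \<le> M0" "\<bar>b\<bar> \<le> W"
      then have "(m, b) \<in> I" by (auto simp: I_def)
      then have "m * N i + b \<in> K i" by (force simp: K_def)
      then have "\<bar>r (m * N i + b) \<omega> - Q i (m * N i + b)\<bar> \<le> \<eta>" using i by (simp add: F_def)
      then show "\<bar>r (m * N i + b) \<omega> - q b\<bar> \<le> \<eta>" using Q[OF mb(3)] by simp
    qed
  qed
qed

text \<open>Richness speaks of uncountably many patterns and tolerances. Rational patterns on finite
  windows and tolerances 1 / (i + 1) suffice by approximation, and countably many null sets can be
  discarded together.\<close>

lemma AE_rich_strict_mono:
  fixes r :: "int \<Rightarrow> 'a \<Rightarrow> real"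
  assumes ind: "indep_vars (\<lambda>_. borel) r UNIV"
    and D: "\<And>n. distr M borel (r n) = uniform_measure lborel {-1/2..1/2}"
  shows "AE \<omega> in M. rich (\<lambda>n. real_of_int n + r n \<omega>) \<and> strict_mono (\<lambda>n. real_of_int n + r n \<omega>)"
proof -
  have r[measurable]: "r k \<in> borel_measurable M" for k using ind by (simp add: indep_vars_def)
  \<comment> \<open>Discarding the endpoint 1/2 makes neighbouring frequencies strictly
    ordered.\<close>
  have range: "AE \<omega> in M. -1/2 \<le> r k \<omega> \<and> r k \<omega> < 1/2" for k
  proof -
    have "AE x in uniform_measure lborel {-1/2..1/2::real}. -1/2 \<le> x \<and> x < 1/2"
      by (rule AE_uniform_measureI) (use AE_lborel_singleton[of "1/2::real"] in \<open>auto elim!: eventually_mono\<close>)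
    then have "AE x in distr M borel (r k). -1/2 \<le> x \<and> x < 1/2" unfolding D .
    then show ?thesis by (subst (asm) AE_distr_iff) auto
  qed
  \<comment> \<open>A rational approximation of an offset may leave [-1/2, 1/2]; clamping brings it
    back without increasing its distance to the offset.\<close>
  define clamp where "clamp = (\<lambda>x::real. max (-1/2) (min (1/2) x))"
  have clamp: "\<bar>clamp x\<bar> \<le> 1/2" for x by (auto simp: clamp_def)
  have clamp_near: "\<bar>clamp x - y\<bar> \<le> \<bar>x - y\<bar>" if "\<bar>y\<bar> \<le> 1/2" for x y using that by (auto simp: clamp_def)
  \<comment> \<open>Patterns on the window -W..W are coded by rational lists, a countable type, with
    bin b at position b + W.\<close>
  define q where "q = (\<lambda>(W::int) (xs :: rat list) (b::int). clamp (real_of_rat (xs ! nat (b + W))))"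
  have qb: "\<bar>q W xs b\<bar> \<le> 1/2" for W xs b unfolding q_def by (rule clamp)
  have "AE \<omega> in M. \<exists>N>N0. \<forall>m b. 0 < \<bar>m\<bar> \<longrightarrow> \<bar>m\<bar> \<le> max M0 1 \<longrightarrow> \<bar>b\<bar> \<le> max W 0 \<longrightarrow>
        \<bar>r (m * N + b) \<omega> - q (max W 0) xs b\<bar> \<le> 1 / real (Suc i)" for W M0 N0 xs i
    by (rule independent_patterns_recur[OF ind D _ _ qb]) auto
  then have "AE \<omega> in M. \<forall>W M0 N0 xs i. \<exists>N>N0. \<forall>m b. 0 < \<bar>m\<bar> \<longrightarrow> \<bar>m\<bar> \<le> max M0 1 \<longrightarrow> \<bar>b\<bar> \<le> max W 0 \<longrightarrow>
        \<bar>r (m * N + b) \<omega> - q (max W 0) xs b\<bar> \<le> 1 / real (Suc i)"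
    unfolding AE_all_countable by blast
  moreover have "AE \<omega> in M. \<forall>k. -1/2 \<le> r k \<omega> \<and> r k \<omega> < 1/2"
    unfolding AE_all_countable using range by blast
  ultimately show ?thesis
  proof eventually_elim
    fix \<omega>
    assume pat: "\<forall>W M0 N0 xs i. \<exists>N>N0. \<forall>m b. 0 < \<bar>m\<bar> \<longrightarrow> \<bar>m\<bar> \<le> max M0 1 \<longrightarrow> \<bar>b\<bar> \<le> max W 0 \<longrightarrow>
        \<bar>r (m * N + b) \<omega> - q (max W 0) xs b\<bar> \<le> 1 / real (Suc i)"
      and rng: "\<forall>k. -1/2 \<le> r k \<omega> \<and> r k \<omega> < 1/2"
    let ?lam = "\<lambda>n. real_of_int n + r n \<omega>"
    have "strict_mono ?lam"
    proof (rule strict_monoI)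
      fix m n :: int assume "m < n"
      then have "real_of_int m + 1 \<le> real_of_int n" by linarith
      moreover have "r m \<omega> < 1/2" "-1/2 \<le> r n \<omega>" using rng by blast+
      ultimately show "?lam m < ?lam n" by linarith
    qed
    moreover have "rich ?lam"
      unfolding rich_def
    proof (intro conjI allI impI)
      show "near_integers ?lam" unfolding near_integers_def
      proof
        fix k
        have "-1/2 \<le> r k \<omega>" "r k \<omega> < 1/2" using rng by blast+
        then show "\<bar>?lam k - of_int k\<bar> \<le> 1/2" by linarith
      qed
    next
      fix W :: int and p :: "int \<Rightarrow> real" assume p: "\<forall>b. \<bar>p b\<bar> \<le> 1/2"
      show "pattern_recurs ?lam W p" unfolding pattern_recurs_def
      proof (intro allI impI)
        fix M0 N0 :: int and \<eta> :: real assume \<eta>: "\<eta> > 0"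
        then obtain i :: nat where "1 / (\<eta> / 2) < real i" using reals_Archimedean2 by blast
        then have i: "1 / real (Suc i) \<le> \<eta> / 2" using \<eta> by (simp add: field_simps)
        have "\<exists>x. \<bar>real_of_rat x - p b\<bar> \<le> \<eta> / 2" for b
        proof -
          obtain x where "p b < real_of_rat x" "real_of_rat x < p b + \<eta> / 2"
            using of_rat_dense[of "p b" "p b + \<eta> / 2"] \<eta> by auto
          then show ?thesis by (intro exI[of _ x]) auto
        qed
        then obtain x where x: "\<And>b. \<bar>real_of_rat (x b) - p b\<bar> \<le> \<eta> / 2" by metis
        define V where "V = max W 0"
        define xs where "xs = map (\<lambda>j. x (int j - V)) [0..<nat (2 * V + 1)]"
        have qp: "\<bar>q V xs b - p b\<bar> \<le> \<eta> / 2" if b: "\<bar>b\<bar> \<le> V" for b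
        proof -
          have "0 \<le> b + V" "nat (b + V) < nat (2 * V + 1)" using b by linarith+
          then have "xs ! nat (b + V) = x b" using b by (simp add: xs_def)
          then have "\<bar>q V xs b - p b\<bar> \<le> \<bar>real_of_rat (x b) - p b\<bar>"
            using clamp_near p by (simp add: q_def)
          then show ?thesis using x[of b] by linarith
        qed
        obtain N where N: "N > N0" "\<And>m b. 0 < \<bar>m\<bar> \<Longrightarrow> \<bar>m\<bar> \<le> max M0 1 \<Longrightarrow> \<bar>b\<bar> \<le> V \<Longrightarrow>
            \<bar>r (m * N + b) \<omega> - q V xs b\<bar> \<le> 1 / real (Suc i)"
          using pat unfolding V_def by blast
        show "\<exists>N>N0. \<forall>m b. 0 < \<bar>m\<bar> \<longrightarrow> \<bar>m\<bar> \<le> M0 \<longrightarrow> \<bar>b\<bar> \<le> W \<longrightarrow> \<bar>?lam (m * N + b) - (of_int (m * N + b) + p b)\<bar> \<le> \<eta>"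
        proof (intro exI[of _ N] conjI N(1) allI impI)
          fix m b :: int assume "0 < \<bar>m\<bar>" "\<bar>m\<bar> \<le> M0" "\<bar>b\<bar> \<le> W"
          then have "\<bar>r (m * N + b) \<omega> - q V xs b\<bar> \<le> \<eta> / 2" "\<bar>q V xs b - p b\<bar> \<le> \<eta> / 2"
            using N(2)[of m b] qp[of b] i by (auto simp: V_def)
          then show "\<bar>?lam (m * N + b) - (of_int (m * N + b) + p b)\<bar> \<le> \<eta>" by linarith
        qed
      qed
    qed
    ultimately show "rich ?lam \<and> strict_mono ?lam" by blast
  qed
qed

end

theorem mainTheorem1:
  fixes M :: "'a measure" and r :: "int \<Rightarrow> 'a \<Rightarrow> real"
  assumes "prob_space M"
    and "prob_space.indep_vars M (\<lambda>_. borel) r UNIV"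
    and "\<And>n. distr M borel (r n) = uniform_measure lborel {-1/2..1/2}"
  shows "AE \<omega> in M. Menshov_spectrum (\<lambda>n. real_of_int n + r n \<omega>)"
proof -
  interpret prob_space M by fact
  show ?thesis
    using AE_rich_strict_mono[OF assms(2,3)] 
    by (rule eventually_mono) (blast intro: rich_imp_Menshov_spectrum)
qed

end
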